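(* Let $H\in C^2(\mathbb{T}^n\times\mathbb{R}^n)$ satisfy (H1) and (H2), and assume the ergodic constant of $H$ is $0$. Let $w_1,w_2\in C(\mathbb{T}^n)$ be two viscosity solutions of $$H(x,Dw)=0\quad\text{in }\mathbb{T}^n.$$ Assume that $$\iint_{\mathbb{T}^n\times\mathbb{R}^n} w_1(x)\,d\mu(x,v)\le \iint_{\mathbb{T}^n\times\mathbb{R}^n} w_2(x)\,d\mu(x,v)\qquad\text{for all }\mu\in\widetilde{\mathcal{M}}.$$ Then $w_1\le w_2$ on $\mathbb{T}^n$.
   Context: $\mathbb{T}^n$ is the $n$-dimensional flat torus. Assumptions on $H\in C^2(\mathbb{T}^n\times\mathbb{R}^n)$: (H1) for every $x\in\mathbb{T}^n$, $p\mapsto H(x,p)$ is convex; (H2) uniformly in $x\in\mathbb{T}^n$, $\lim_{|p|\to\infty}H(x,p)/|p|=+\infty$ and $\lim_{|p|\to\infty}\big(\tfrac12 H(x,p)^2+D_xH(x,p)\cdot p\big)=+\infty$. The ergodic constant of $H$ is the unique $c\in\mathbb{R}$ such that $H(x,Dw)=c$ in $\mathbb{T}^n$ has a viscosity solution $w\in C(\mathbb{T}^n)$; it is assumed that $c=0$. $L(x,v)=\sup_{p\in\mathbb{R}^n}(p\cdot v-H(x,p))$ is the Legendre transform of $H$. $\mathcal{P}(\mathbb{T}^n\times\mathbb{R}^n)$ denotes Radon probability measures on $\mathbb{T}^n\times\mathbb{R}^n$. The set of holonomic measures is $$\mathcal{F}=\Big\{\mu\in\mathcal{P}(\mathbb{T}^n\times\mathbb{R}^n):\iint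 v\cdot D\phi(x)\,d\mu(x,v)=0\ \text{for all }\phi\in C^1(\mathbb{T}^n)\Big\}.$$ The set of Mather measures $\widetilde{\mathcal{M}}\subset\mathcal{F}$ is the set of minimizers of $\mu\mapsto\iint L(x,v)\,d\mu(x,v)$ over $\mathcal{F}$ (under $c=0$ this minimum equals $0$). *)

theory Defs
  imports "HOL-Analysis.Analysis" "HOL-Probability.Probability"
begin

text \<open>The flat torus T^n is modelled via Z^n-periodic objects on real^'n.\<close>

definition int_vec :: "real^'n \<Rightarrow> bool" where
  "int_vec k \<longleftrightarrow> (\<forall>i. k $ i \<in> \<int>)"

definition periodic_fun :: "(real^'n \<Rightarrow> 'b) \<Rightarrow> bool" where
  "periodic_fun f \<longleftrightarrow> (\<forall>x k. int_vec k \<longrightarrow> f (x + k) = f x)"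

text \<open>Fundamental cell [0,1)^n, identified with T^n.\<close>
definition unit_cell :: "(real^'n) set" where
  "unit_cell = {x. \<forall>i. 0 \<le> x $ i \<and> x $ i < 1}"

definition grad :: "(real^'n \<Rightarrow> real) \<Rightarrow> real^'n \<Rightarrow> real^'n" where
  "grad f x = (\<chi> i. frechet_derivative f (at x) (axis i 1))"

definition C1_fun :: "(real^'n \<Rightarrow> real) \<Rightarrow> bool" where
  "C1_fun f \<longleftrightarrow> (\<exists>g. continuous_on UNIV g \<and> (\<forall>x. (f has_derivative (\<lambda>h. g x \<bullet> h)) (at x)))"

definition C2_fun :: "('a::real_normed_vector \<Rightarrow> real) \<Rightarrow> bool" where
  "C2_fun f \<longleftrightarrow> (\<exists>(D :: 'a \<Rightarrow> 'a \<Rightarrow>\<^sub>L real) (D2 :: 'a \<Rightarrow> 'a \<Rightarrow>\<^sub>L ('a \<Rightarrow>\<^sub>L real)).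
      (\<forall>z. (f has_derivative blinfun_apply (D z)) (at z)) \<and>
      (\<forall>z. (D has_derivative blinfun_apply (D2 z)) (at z)) \<and>
      continuous_on UNIV D2)"

definition hamiltonian_ok :: "(real^'n \<Rightarrow> real^'n \<Rightarrow> real) \<Rightarrow> bool" where
  "hamiltonian_ok H \<longleftrightarrow>
     (\<forall>x p k. int_vec k \<longrightarrow> H (x + k) p = H x p) \<and>
     C2_fun (\<lambda>(x, p). H x p) \<and>
     (\<forall>x. convex_on UNIV (H x)) \<and>
     (\<forall>M. \<exists>R. \<forall>x p. norm p \<ge> R \<longrightarrow> H x p \<ge> M * norm p) \<and>
     (\<forall>M. \<exists>R. \<forall>x p. norm p \<ge> R \<longrightarrow>
         (1/2) * (H x p)\<^sup>2 + frechet_derivative (\<lambda>y. H y p) (at x) p \<ge> M)"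

definition visc_subsol :: "(real^'n \<Rightarrow> real^'n \<Rightarrow> real) \<Rightarrow> real \<Rightarrow> (real^'n \<Rightarrow> real) \<Rightarrow> bool" where
  "visc_subsol H c w \<longleftrightarrow> (\<forall>\<phi> x0. C1_fun \<phi> \<and>
      (\<exists>r>0. \<forall>y\<in>ball x0 r. w y - \<phi> y \<le> w x0 - \<phi> x0) \<longrightarrow> H x0 (grad \<phi> x0) \<le> c)"

definition visc_supersol :: "(real^'n \<Rightarrow> real^'n \<Rightarrow> real) \<Rightarrow> real \<Rightarrow> (real^'n \<Rightarrow> real) \<Rightarrow> bool" where
  "visc_supersol H c w \<longleftrightarrow> (\<forall>\<phi> x0. C1_fun \<phi> \<and>
      (\<exists>r>0. \<forall>y\<in>ball x0 r. w y - \<phi> y \<ge> w x0 - \<phi> x0) \<longrightarrow> H x0 (grad \<phi> x0) \<ge> c)"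

definition visc_sol :: "(real^'n \<Rightarrow> real^'n \<Rightarrow> real) \<Rightarrow> real \<Rightarrow> (real^'n \<Rightarrow> real) \<Rightarrow> bool" where
  "visc_sol H c w \<longleftrightarrow> continuous_on UNIV w \<and> periodic_fun w \<and>
      visc_subsol H c w \<and> visc_supersol H c w"

definition ergodic_constant :: "(real^'n \<Rightarrow> real^'n \<Rightarrow> real) \<Rightarrow> real" where
  "ergodic_constant H = (THE c. \<exists>w. visc_sol H c w)"

definition lagrangian :: "(real^'n \<Rightarrow> real^'n \<Rightarrow> real) \<Rightarrow> real^'n \<Rightarrow> real^'n \<Rightarrow> real" where
  "lagrangian H x v = (SUP p. p \<bullet> v - H x p)"

text \<open>Probability measures on T^n x R^n, represented as Borel probability measures on
  R^n x R^n concentrated on unit_cell x R^n.\<close>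
definition prob_TR :: "((real^'n) \<times> (real^'n)) measure \<Rightarrow> bool" where
  "prob_TR \<mu> \<longleftrightarrow> sets \<mu> = sets borel \<and> prob_space \<mu> \<and>
      emeasure \<mu> (unit_cell \<times> UNIV) = 1"

definition holonomic :: "((real^'n) \<times> (real^'n)) measure set" where
  "holonomic = {\<mu>. prob_TR \<mu> \<and>
      (\<forall>\<phi>. C1_fun \<phi> \<and> periodic_fun \<phi> \<longrightarrow>
          integrable \<mu> (\<lambda>(x, v). v \<bullet> grad \<phi> x) \<and>
          (\<integral>(x, v). v \<bullet> grad \<phi> x \<partial>\<mu>) = 0)}"

definition mather_measures :: "(real^'n \<Rightarrow> real^'n \<Rightarrow> real) \<Rightarrow> ((real^'n) \<times> (real^'n)) measure set" where
  "mather_measures H = {\<mu>. \<mu> \<in> holonomic \<and>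
      integrable \<mu> (\<lambda>(x, v). lagrangian H x v) \<and>
      (\<forall>\<nu>\<in>holonomic. integrable \<nu> (\<lambda>(x, v). lagrangian H x v) \<longrightarrow>
          (\<integral>(x, v). lagrangian H x v \<partial>\<mu>) \<le> (\<integral>(x, v). lagrangian H x v \<partial>\<nu>))}"

end

theory Submission
  imports Defs
begin


text \<open>Let \<open>m\<close> be the minimum of \<open>w2 - w1\<close> over the torus. The key fact is that some Mather measure
  \<open>\<mu>\<close> is concentrated where \<open>w2 - w1 = m\<close>; integrating the hypothesis against it gives \<open>m \<ge> 0\<close>.

  Such a measure exists by convex duality: otherwise a finite-dimensional separation yields a
  \<open>C\<^sup>1\<close> periodic function \<open>\<psi>\<close> with \<open>H(x, D\<psi>) < w2 - w1 - m\<close> everywhere. Then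
  \<open>t \<psi> + (1 - t) w1\<close> is a subsolution of \<open>H \<le> t (w2 - w1 - m - \<epsilon>)\<close>; comparing it with the supersolution
  \<open>w2\<close> at a maximum point of the difference and letting \<open>t \<rightarrow> 0\<close> contradicts the definition of \<open>m\<close>.
  That the measure minimises the action follows from \<open>C\<^sup>1\<close> approximate subsolutions, obtained by
  mollifying \<open>w1\<close>.

  Compactness of measures is taken from Helly's theorem on the real line by pulling everything back
  along a space-filling curve of the compact part of phase space.\<close>

text \<open>The solutions are only continuous, so \<open>w1\<close> has no gradient to compare or to
  average. Its substitute is the bound of \<open>viscosity_increment\<close> on increments: it is
  stated through test functions alone, and averaging over translates preserves it. Separation from a
  convex sublevel set of \<open>H x0\<close> turns these increments back into a bound on the
  gradient of the mollification.

  The duality is posed as a system of one-sided moment inequalities: the action plus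
  \<open>w2 - w1 - m\<close> has nonpositive integral, and so has
  \<open>- (v \<bullet> grad \<phi> x)\<close> for every test function \<open>\<phi>\<close>. Since
  the action of a holonomic measure and \<open>w2 - w1 - m\<close> both have nonnegative integrals,
  the first inequality makes both vanish: minimality and concentration come from a single
  constraint. A countable family of test functions with dense gradients allows finitely many
  inequalities to be treated at a time, with errors that disappear in the weak limit.\<close>

lemma C1_funE:
  fixes f :: "real^'n \<Rightarrow> real"
  assumes "C1_fun f"
  shows "continuous_on UNIV (grad f)" "(f has_derivative (\<lambda>h. grad f x \<bullet> h)) (at x)"
proof -
  obtain g where g: "continuous_on UNIV g" "\<And>x. (f has_derivative (\<lambda>h. g x \<bullet> h)) (at x)"
    using assms unfolding C1_fun_def by blast
  have "grad f x = g x" for x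
    unfolding grad_def frechet_derivative_at[OF g(2)[of x], symmetric]
    by (simp add: vec_eq_iff inner_axis)
  then have "grad f = g" by blast
  then show "continuous_on UNIV (grad f)" "(f has_derivative (\<lambda>h. grad f x \<bullet> h)) (at x)"
    using g by auto
qed

lemma grad_eqI:
  fixes f :: "real^'n \<Rightarrow> real"
  assumes "(f has_derivative (\<lambda>h. g \<bullet> h)) (at x)"
  shows "grad f x = g"
  unfolding grad_def frechet_derivative_at[OF assms, symmetric]
  by (simp add: vec_eq_iff inner_axis)

lemma C1_funI:
  fixes f :: "real^'n \<Rightarrow> real"
  assumes "continuous_on UNIV g" "\<And>x. (f has_derivative (\<lambda>h. g x \<bullet> h)) (at x)"
  shows "C1_fun f" "grad f = g"
  using assms grad_eqI unfolding C1_fun_def by blast+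

lemma C1_fun_continuous: "C1_fun f \<Longrightarrow> continuous_on UNIV f"
  by (meson C1_funE(2) continuous_at_imp_continuous_on has_derivative_continuous)

lemma C1_fun_sum:
  fixes f :: "'i \<Rightarrow> real^'n \<Rightarrow> real"
  assumes "\<And>i. i \<in> I \<Longrightarrow> C1_fun (f i)"
  shows "C1_fun (\<lambda>x. \<Sum>i\<in>I. c i * f i x)"
    and "grad (\<lambda>x. \<Sum>i\<in>I. c i * f i x) = (\<lambda>x. \<Sum>i\<in>I. c i *\<^sub>R grad (f i) x)"
proof -
  have "((\<lambda>x. \<Sum>i\<in>I. c i * f i x) has_derivative (\<lambda>h. (\<Sum>i\<in>I. c i *\<^sub>R grad (f i) x) \<bullet> h)) (at x)" for x
    by (auto intro!: derivative_eq_intros C1_funE(2) assms simp: inner_sum_left)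
  moreover have "continuous_on UNIV (\<lambda>x. \<Sum>i\<in>I. c i *\<^sub>R grad (f i) x)"
    by (intro continuous_intros C1_funE(1) assms)
  ultimately show "C1_fun (\<lambda>x. \<Sum>i\<in>I. c i * f i x)"
    "grad (\<lambda>x. \<Sum>i\<in>I. c i * f i x) = (\<lambda>x. \<Sum>i\<in>I. c i *\<^sub>R grad (f i) x)"
    by (auto dest: C1_funI)
qed

lemma C1_fun_lincomb:
  fixes f g :: "real^'n \<Rightarrow> real"
  assumes "C1_fun f" "C1_fun g"
  shows "C1_fun (\<lambda>x. a * f x + b * g x)"
    and "grad (\<lambda>x. a * f x + b * g x) = (\<lambda>x. a *\<^sub>R grad f x + b *\<^sub>R grad g x)"
proof -
  have "((\<lambda>x. a * f x + b * g x) has_derivative (\<lambda>h. (a *\<^sub>R grad f x + b *\<^sub>R grad g x) \<bullet> h)) (at x)" for x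
    by (auto intro!: derivative_eq_intros C1_funE(2) assms simp: inner_left_distrib)
  moreover have "continuous_on UNIV (\<lambda>x. a *\<^sub>R grad f x + b *\<^sub>R grad g x)"
    by (intro continuous_intros C1_funE(1) assms)
  ultimately show "C1_fun (\<lambda>x. a * f x + b * g x)"
    "grad (\<lambda>x. a * f x + b * g x) = (\<lambda>x. a *\<^sub>R grad f x + b *\<^sub>R grad g x)"
    by (auto dest: C1_funI)
qed

lemma periodic_grad:
  fixes f :: "real^'n \<Rightarrow> real"
  assumes "C1_fun f" "periodic_fun f"
  shows "periodic_fun (grad f)"
  unfolding periodic_fun_def
proof (intro allI impI)
  fix x k :: "real^'n" assume k: "int_vec k"
  have "((\<lambda>y. f (y + k)) has_derivative (\<lambda>h. grad f (x + k) \<bullet> h)) (at x)"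
    by (rule has_derivative_compose[where f = "\<lambda>y. y + k" and g = f and f' = "\<lambda>h. h"])
       (auto intro!: derivative_eq_intros C1_funE(2) assms)
  moreover have "(\<lambda>y. f (y + k)) = f" using assms k by (auto simp: periodic_fun_def)
  ultimately show "grad f (x + k) = grad f x" by (metis grad_eqI)
qed

section \<open>Periodic functions\<close>

text \<open>The half-open cell is not compact; its closure serves for extrema and uniform continuity
  of periodic functions.\<close>

definition unit_cube :: "(real^'n) set" where
  "unit_cube = cbox 0 (\<chi> i. 1)"

definition frac_vec :: "real^'n \<Rightarrow> real^'n" where
  "frac_vec x = (\<chi> i. frac (x $ i))"

lemma frac_vec_cell: "frac_vec x \<in> unit_cell"
  by (simp add: frac_vec_def unit_cell_def frac_lt_1)

lemma unit_cell_subset_cube: "unit_cell \<subseteq> unit_cube"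
  by (auto simp: unit_cell_def unit_cube_def mem_box_cart less_imp_le)

lemma compact_unit_cube: "compact unit_cube"
  by (simp add: unit_cube_def compact_cbox)

lemma unit_cube_nonempty: "0 \<in> unit_cube"
  by (auto simp: unit_cube_def mem_box_cart)

lemma frac_vec_eq_add_int_vec:
  fixes x :: "real^'n"
  shows "\<exists>k. int_vec k \<and> frac_vec x = x + k"
proof -
  let ?k = "- (\<chi> i. real_of_int \<lfloor>x $ i\<rfloor>) :: real^'n"
  have "int_vec ?k" "frac_vec x = x + ?k"
    by (auto simp: int_vec_def frac_vec_def vec_eq_iff frac_def)
  then show ?thesis by blast
qed

lemma periodic_frac: "periodic_fun f \<Longrightarrow> f (frac_vec x) = f x"
  using frac_vec_eq_add_int_vec[of x] by (auto simp: periodic_fun_def)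

lemma frac_vec_cube: "frac_vec x \<in> unit_cube"
  using frac_vec_cell unit_cell_subset_cube by blast

lemma frac_vec_measurable [measurable]: "(frac_vec :: real^'b \<Rightarrow> real^'b) \<in> borel_measurable borel"
proof -
  have [measurable]: "(frac :: real \<Rightarrow> real) \<in> borel_measurable borel"
    unfolding frac_def by measurable
  have [measurable]: "(\<lambda>x::real^'b. x $ i) \<in> borel_measurable borel" for i
    by (intro borel_measurable_continuous_onI continuous_intros)
  show ?thesis unfolding frac_vec_def
    by (subst borel_measurable_euclidean_space) (auto simp: Basis_vec_def inner_axis)
qed

lemma periodic_attains_sup:
  fixes f :: "real^'n \<Rightarrow> real"
  assumes "continuous_on UNIV f" "periodic_fun f"
  shows "\<exists>x. \<forall>y. f y \<le> f x"
proof -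
  obtain x where "\<And>y. y \<in> unit_cube \<Longrightarrow> f y \<le> f x"
    using continuous_attains_sup[OF compact_unit_cube _ continuous_on_subset[OF assms(1)]]
      unit_cube_nonempty by (metis empty_iff subset_UNIV)
  then show ?thesis using frac_vec_cube periodic_frac[OF assms(2)] by metis
qed

lemma periodic_bounded:
  fixes f :: "real^'n \<Rightarrow> real"
  assumes "continuous_on UNIV f" "periodic_fun f"
  obtains B where "B > 0" "\<And>y. \<bar>f y\<bar> \<le> B"
proof -
  have "continuous_on UNIV (\<lambda>x. \<bar>f x\<bar>)" using assms by (intro continuous_intros)
  moreover have "periodic_fun (\<lambda>x. \<bar>f x\<bar>)" using assms by (simp add: periodic_fun_def)
  ultimately have "\<exists>x. \<forall>y. \<bar>f y\<bar> \<le> \<bar>f x\<bar>" by (rule periodic_attains_sup)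
  then obtain x where x: "\<And>y. \<bar>f y\<bar> \<le> \<bar>f x\<bar>" by blast
  show thesis by (rule that[of "\<bar>f x\<bar> + 1"]) (use x in \<open>auto intro: add_nonneg_pos order_trans[OF x]\<close>)
qed

text \<open>Squaring removes the kink of the positive part: at 0 the difference quotient is at most
  \<open>\<bar>h\<bar>\<close>. This makes the one-sided penalty and the mollifying kernel below
  C1.\<close>

lemma has_derivative_pos_part_sq:
  "((\<lambda>t::real. (max 0 t)\<^sup>2) has_real_derivative 2 * max 0 t) (at t)"
proof -
  consider "t > 0" | "t < 0" | "t = 0" by linarith
  then show ?thesis
  proof cases
    case 1
    have "((\<lambda>t::real. t\<^sup>2) has_real_derivative 2 * t) (at t)"
      by (auto intro!: derivative_eq_intros)
    then have "((\<lambda>t::real. (max 0 t)\<^sup>2) has_real_derivative 2 * t) (at t)"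
      by (rule has_field_derivative_transform_within_open[of _ _ _ "{0<..}"]) (use 1 in auto)
    then show ?thesis using 1 by simp
  next
    case 2
    have "((\<lambda>t::real. 0) has_real_derivative 0) (at t)" by simp
    then have "((\<lambda>t::real. (max 0 t)\<^sup>2) has_real_derivative 0) (at t)"
      by (rule has_field_derivative_transform_within_open[of _ _ _ "{..<0}"]) (use 2 in auto)
    then show ?thesis using 2 by simp
  next
    case 3
    have "((\<lambda>h::real. (max 0 h)\<^sup>2 / h) \<longlongrightarrow> 0) (at 0)"
    proof (rule Lim_null_comparison)
      show "\<forall>\<^sub>F h::real in at 0. norm ((max 0 h)\<^sup>2 / h) \<le> \<bar>h\<bar>"
        by (rule always_eventually) (auto simp: max_def power2_eq_square)
      show "((\<lambda>h::real. \<bar>h\<bar>) \<longlongrightarrow> 0) (at 0)" by (rule tendsto_eq_intros | simp)+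
    qed
    then show ?thesis using 3 by (simp add: DERIV_def)
  qed
qed


section \<open>Mollification of viscosity subsolutions\<close>

text \<open>If the increment exceeded \<open>s\<close>, a penalised function whose slope along
  \<open>h\<close> is slightly larger than \<open>s\<close> would touch \<open>w\<close> from above
  at an interior point of a half ball, against \<open>touch\<close>.\<close>

lemma viscosity_increment:
  fixes w :: "real^'n \<Rightarrow> real"
  assumes cont: "continuous_on UNIV w" and bdd: "\<And>z. \<bar>w z\<bar> \<le> B" and h: "h \<noteq> 0"
    and touch: "\<And>\<phi> z. C1_fun \<phi> \<Longrightarrow> z \<in> ball y (2 * norm h) \<Longrightarrow>
        \<exists>r>0. \<forall>u\<in>ball z r. w u - \<phi> u \<le> w z - \<phi> z \<Longrightarrow> grad \<phi> z \<bullet> h \<le> s"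
  shows "w (y + h) - w y \<le> s"
proof (rule ccontr)
  assume contra: "\<not> ?thesis"
  define D where "D = w (y + h) - w y - s"
  have D: "D > 0" using contra by (simp add: D_def)
  \<comment> \<open>Half of the excess steepens the test function; the other half keeps the contact
    point off the face through \<open>y\<close>.\<close>
  define s' where "s' = s + D / 2"
  define a where "a = h \<bullet> h"
  have a: "a > 0" using h by (simp add: a_def)
  have B: "B \<ge> 0" using bdd[of 0] by linarith
  \<comment> \<open>\<open>\<tau>\<close> is the coordinate along \<open>h\<close>, equal to 0 at
    \<open>y\<close> and 1 at \<open>y + h\<close>; \<open>O'\<close> is the squared distance to the
    line through these points.\<close>
  define \<tau> where "\<tau> z = ((z - y) \<bullet> h) / a" for z
  define O' where "O' z = (z - y) \<bullet> (z - y) - a * (\<tau> z)\<^sup>2" for z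
  have O'_nonneg: "O' z \<ge> 0" for z
  proof -
    have "((z - y) \<bullet> h)\<^sup>2 \<le> ((z - y) \<bullet> (z - y)) * a" unfolding a_def by (rule Cauchy_Schwarz_ineq)
    then show ?thesis using a by (simp add: O'_def \<tau>_def power2_eq_square field_simps)
  qed
  obtain d where d: "d > 0" "\<And>z. dist z y < d \<Longrightarrow> \<bar>w z - w y\<bar> < D / 4"
  proof -
    have "continuous (at y) w" using cont by (simp add: continuous_on_eq_continuous_at)
    then show thesis using that D unfolding continuous_at_eps_delta dist_real_def
      by (metis zero_less_divide_iff zero_less_numeral)
  qed
  define M where "M = 2 * B + 3 * \<bar>s'\<bar> + 1"
  have M: "M > 0" using B by (simp add: M_def)
  \<comment> \<open>The summands rule out three places for the contact point: the sphere far along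
    \<open>h\<close> (\<open>4 * M\<close>, as \<open>\<tau> - 1\<close> is at least 1/2 there), the
    sphere away from the line (\<open>M / a\<close>), and the face \<open>\<tau> = 0\<close> at
    distance at least \<open>d\<close> from \<open>y\<close> (the last one).\<close>
  define A where "A = 4 * M + M / a + 2 * B / d\<^sup>2"
  have sum3: "4 * M > 0" "M / a > 0" "2 * B / d\<^sup>2 \<ge> 0" using M B a d by auto
  have A0: "A > 0" using sum3 unfolding A_def by (intro add_pos_nonneg) auto
  have A1: "A / 4 \<ge> M" using sum3 by (simp add: A_def add_divide_distrib)
  have "M / a \<le> A" using sum3 by (simp add: A_def)
  moreover have "2 * B / d\<^sup>2 \<le> A" using sum3 by (simp add: A_def)
  ultimately have A2: "A * a \<ge> M" and A3: "A * d\<^sup>2 \<ge> 2 * B"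
    using a d by (simp_all add: divide_le_eq)
  define \<Psi> where "\<Psi> z = s' * \<tau> z + A * O' z + A * (max 0 (\<tau> z - 1))\<^sup>2" for z
  define g where "g z = (s' / a) *\<^sub>R h + A *\<^sub>R (2 *\<^sub>R (z - y) - (2 * \<tau> z) *\<^sub>R h)
                     + (A * (2 * max 0 (\<tau> z - 1)) / a) *\<^sub>R h" for z
  have der\<tau>: "(\<tau> has_derivative (\<lambda>k. (k \<bullet> h) / a)) (at z)" for z
  proof -
    have "((\<lambda>z. ((z - y) \<bullet> h) * inverse a) has_derivative (\<lambda>k. (k \<bullet> h) * inverse a)) (at z)"
      by (auto intro!: derivative_eq_intros)
    then show ?thesis by (simp add: \<tau>_def[abs_def] divide_inverse)
  qed
  have der3: "((\<lambda>z. (max 0 (\<tau> z - 1))\<^sup>2) has_derivative (\<lambda>k. 2 * max 0 (\<tau> z - 1) * ((k \<bullet> h) / a))) (at z)" for z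
  proof -
    have "((\<lambda>z. \<tau> z - 1) has_derivative (\<lambda>k. (k \<bullet> h) / a)) (at z)"
      using der\<tau> by (auto intro!: derivative_eq_intros)
    from has_derivative_compose[OF this has_derivative_pos_part_sq[unfolded has_field_derivative_def]]
    show ?thesis by simp
  qed
  have der: "(\<Psi> has_derivative (\<lambda>k. g z \<bullet> k)) (at z)" for z
    unfolding \<Psi>_def[abs_def] O'_def
    by (rule derivative_eq_intros der\<tau> der3 refl)+
       (use a in \<open>auto simp: g_def inner_simps fun_eq_iff field_simps inner_commute\<close>)
  have "continuous_on UNIV \<tau>"
    using der\<tau> by (meson continuous_at_imp_continuous_on has_derivative_continuous)
  then have "continuous_on UNIV g"
    unfolding g_def[abs_def] by (intro continuous_intros) (use a in auto)
  from C1_funI[OF this der] have C1: "C1_fun \<Psi>" and grad: "grad \<Psi> = g" by auto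
  have cont\<Psi>: "continuous_on UNIV \<Psi>" using C1 by (rule C1_fun_continuous)
  \<comment> \<open>Half ball with \<open>y\<close> on its flat face. A maximum point off the face
    and off the sphere is a local maximum in the full space, as \<open>touch\<close>
    requires.\<close>
  define Q where "Q = cball y (2 * norm h) \<inter> {z. 0 \<le> \<tau> z}"
  have "closed {z. 0 \<le> \<tau> z}"
    using \<open>continuous_on UNIV \<tau>\<close> by (intro closed_Collect_le continuous_intros)
  then have "compact Q" unfolding Q_def by (intro compact_Int_closed) auto
  have \<tau>1: "\<tau> (y + h) = 1" using a by (simp add: \<tau>_def a_def)
  have yhQ: "y + h \<in> Q" using \<tau>1 by (auto simp: Q_def dist_norm)
  have cd: "continuous_on UNIV (\<lambda>z. w z - \<Psi> z)" by (intro continuous_intros cont cont\<Psi>)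
  obtain z where z: "z \<in> Q" "\<And>u. u \<in> Q \<Longrightarrow> w u - \<Psi> u \<le> w z - \<Psi> z"
    using continuous_attains_sup[OF \<open>compact Q\<close> _ continuous_on_subset[OF cd subset_UNIV]] yhQ by blast
  have \<Psi>yh: "\<Psi> (y + h) = s'" using \<tau>1 by (simp add: \<Psi>_def O'_def a_def)
  then have lower: "w z - \<Psi> z \<ge> w (y + h) - s'" using z(2)[OF yhQ] by simp
  have pos3: "A * (max 0 (\<tau> z - 1))\<^sup>2 \<ge> 0" "A * O' z \<ge> 0" using A0 O'_nonneg by auto
  have "\<tau> z > 0"
  proof (rule ccontr)
    assume "\<not> 0 < \<tau> z"
    then have "\<tau> z = 0" using z by (auto simp: Q_def)
    then have "\<Psi> z = A * (dist z y)\<^sup>2"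
      by (simp add: \<Psi>_def O'_def dist_norm power2_norm_eq_inner)
    then have *: "w z - A * (dist z y)\<^sup>2 \<ge> w y + D / 2" using lower by (simp add: s'_def D_def field_simps)
    show False
    proof (cases "dist z y < d")
      case True
      have "A * (dist z y)\<^sup>2 \<ge> 0" using A0 by simp
      then show False using * d(2)[OF True] D by linarith
    next
      case False
      then have "A * d\<^sup>2 \<le> A * (dist z y)\<^sup>2" using A0 d by (intro mult_left_mono power_mono) auto
      then show False using * A3 bdd[of z] bdd[of y] D by linarith
    qed
  qed
  moreover have "dist y z < 2 * norm h"
  proof (rule ccontr)
    assume "\<not> dist y z < 2 * norm h"
    then have eq: "dist y z = 2 * norm h" using z by (auto simp: Q_def)
    have zz: "(z - y) \<bullet> (z - y) = 4 * a"
      using eq by (simp add: a_def power2_norm_eq_inner[symmetric] dist_norm norm_minus_commute power_mult_distrib)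
    then have "a * (\<tau> z)\<^sup>2 \<le> a * 2\<^sup>2" using O'_nonneg[of z] by (simp add: O'_def)
    then have "(\<tau> z)\<^sup>2 \<le> 2\<^sup>2" using a by simp
    then have t2: "\<tau> z \<le> 2" by (rule power2_le_imp_le) simp
    have st: "- (s' * \<tau> z) \<le> 2 * \<bar>s'\<bar>"
    proof -
      have "- (s' * \<tau> z) \<le> \<bar>s' * \<tau> z\<bar>" by simp
      also have "\<dots> \<le> \<bar>s'\<bar> * 2" unfolding abs_mult using t2 \<open>\<tau> z > 0\<close> by (intro mult_left_mono) auto
      finally show ?thesis by simp
    qed
    \<comment> \<open>On the sphere \<open>O' z = 4 * a - a * (\<tau> z)\<^sup>2\<close>, so one of
      the two penalties is large, according to whether \<open>\<tau> z\<close> reaches 3/2.\<close>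
    have "A * O' z + A * (max 0 (\<tau> z - 1))\<^sup>2 \<ge> M"
    proof (cases "\<tau> z \<ge> 3/2")
      case True
      have "1/2 \<le> max 0 (\<tau> z - 1)" using True by (auto simp: le_max_iff_disj)
      then have "(1/2)\<^sup>2 \<le> (max 0 (\<tau> z - 1))\<^sup>2" by (rule power_mono) simp
      then have "A * (1/2)\<^sup>2 \<le> A * (max 0 (\<tau> z - 1))\<^sup>2" by (rule mult_left_mono) (use A0 in simp)
      then show ?thesis using A1 pos3 by (simp add: power2_eq_square)
    next
      case False
      then have "(\<tau> z)\<^sup>2 \<le> (3/2)\<^sup>2" using \<open>\<tau> z > 0\<close> by (intro power_mono) auto
      then have "a * (\<tau> z)\<^sup>2 \<le> a * (3/2)\<^sup>2" using a by (intro mult_left_mono) auto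
      then have "a \<le> O' z" using zz a by (simp add: O'_def power2_eq_square)
      then have "A * a \<le> A * O' z" using A0 by simp
      then show ?thesis using A2 pos3 by linarith
    qed
    then show False using lower bdd[of z] bdd[of "y + h"] st B unfolding \<Psi>_def M_def by linarith
  qed
  moreover have "open (ball y (2 * norm h) \<inter> {z. 0 < \<tau> z})"
    using \<open>continuous_on UNIV \<tau>\<close> by (intro open_Int open_Collect_less continuous_intros) auto
  ultimately obtain r where r: "r > 0" "ball z r \<subseteq> ball y (2 * norm h) \<inter> {z. 0 < \<tau> z}"
    by (metis (mono_tags, lifting) IntI mem_Collect_eq mem_ball open_contains_ball)
  have "\<forall>u\<in>ball z r. w u - \<Psi> u \<le> w z - \<Psi> z"
    using r(2) by (auto intro!: z(2) simp: Q_def less_imp_le subset_iff)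
  then have "grad \<Psi> z \<bullet> h \<le> s"
    using touch[OF C1] r(1) \<open>dist y z < 2 * norm h\<close> by auto
  \<comment> \<open>The gradient of \<open>O'\<close> is orthogonal to \<open>h\<close>, and the
    other penalty only adds a nonnegative multiple of \<open>h\<close>; hence the slope is at least
    \<open>s'\<close>, which exceeds \<open>s\<close>.\<close>
  moreover have "g z \<bullet> h = s' + A * (2 * max 0 (\<tau> z - 1))"
    using a by (simp add: g_def inner_simps a_def[symmetric]) (simp add: \<tau>_def field_simps inner_simps)
  moreover have "A * (2 * max 0 (\<tau> z - 1)) \<ge> 0" using A0 by simp
  ultimately show False using D by (simp add: grad s'_def)
qed

text \<open>The square gives one continuous derivative, enough for a C1 mollification. The kernel is
  not normalised; \<open>mollify\<close> divides by its mass.\<close>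

definition bump :: "real \<Rightarrow> real^'n \<Rightarrow> real" where
  "bump \<rho> z = (max 0 (\<rho>\<^sup>2 - z \<bullet> z))\<^sup>2"

definition mollify :: "real \<Rightarrow> (real^'n \<Rightarrow> real) \<Rightarrow> real^'n \<Rightarrow> real" where
  "mollify \<rho> w x = (\<integral>y. bump \<rho> (y - x) * w y \<partial>lborel) / (\<integral>y. bump \<rho> (y::real^'n) \<partial>lborel)"

lemma continuous_bump: "continuous_on S (\<lambda>x. bump \<rho> (f x))" if "continuous_on S f"
  unfolding bump_def by (intro continuous_intros that)

lemma bump_nonneg: "bump \<rho> z \<ge> 0" by (simp add: bump_def)

lemma bump_outside: "bump \<rho> z = 0" if "norm z \<ge> \<rho>" "\<rho> \<ge> 0"
proof -
  have "\<rho>\<^sup>2 \<le> z \<bullet> z" using that by (simp add: power2_norm_eq_inner[symmetric])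
  then show ?thesis by (simp add: bump_def)
qed

lemma integrable_bump:
  fixes w :: "real^'n \<Rightarrow> real"
  assumes "continuous_on UNIV w" "\<rho> \<ge> 0"
  shows "integrable lborel (\<lambda>z. bump \<rho> (z - x) * w z)"
proof -
  have "integrable lborel (\<lambda>z. indicator (cball x \<rho>) z *\<^sub>R (bump \<rho> (z - x) * w z))"
    by (intro borel_integrable_compact compact_cball continuous_intros continuous_bump
        continuous_on_subset[OF assms(1)]) auto
  moreover have "(\<lambda>z. indicator (cball x \<rho>) z *\<^sub>R (bump \<rho> (z - x) * w z)) = (\<lambda>z. bump \<rho> (z - x) * w z)"
    using bump_outside[of \<rho> "_ - x"] assms(2)
    by (auto simp: fun_eq_iff indicator_def dist_norm norm_minus_commute)
  ultimately show ?thesis by metis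
qed

lemma bump_shift:
  fixes w :: "real^'n \<Rightarrow> real"
  assumes "continuous_on UNIV w" "\<rho> \<ge> 0"
  shows "integrable lborel (\<lambda>z. bump \<rho> z * w (x + z))"
    and "(\<integral>y. bump \<rho> (y - x) * w y \<partial>lborel) = (\<integral>z. bump \<rho> z * w (x + z) \<partial>lborel)"
proof -
  have c: "continuous_on UNIV (\<lambda>z. w (x + z))"
    by (rule continuous_on_compose2[OF assms(1)]) (auto intro!: continuous_intros)
  show "integrable lborel (\<lambda>z. bump \<rho> z * w (x + z))"
    using integrable_bump[OF c assms(2), of 0] by simp
  have m: "(\<lambda>y. bump \<rho> (y - x) * w y) \<in> borel_measurable borel"
    by (intro borel_measurable_continuous_onI continuous_intros continuous_bump assms)
  have "(\<integral>y. bump \<rho> (y - x) * w y \<partial>lborel) = (\<integral>y. bump \<rho> (y - x) * w y \<partial>(distr lborel borel ((+) x)))"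
    by (simp add: lborel_distr_plus)
  also have "\<dots> = (\<integral>z. bump \<rho> z * w (x + z) \<partial>lborel)"
    by (subst integral_distr) (use m in auto)
  finally show "(\<integral>y. bump \<rho> (y - x) * w y \<partial>lborel) = (\<integral>z. bump \<rho> z * w (x + z) \<partial>lborel)" .
qed

lemma bump_mass_pos:
  assumes "\<rho> > 0"
  shows "(\<integral>y. bump \<rho> (y::real^'n) \<partial>lborel) > 0"
proof -
  let ?c = "(\<rho>\<^sup>2 * (3/4))\<^sup>2"
  have int: "integrable lborel (\<lambda>z::real^'n. bump \<rho> z)"
    using integrable_bump[of "\<lambda>_. 1" \<rho> 0] assms by simp
  have "(\<integral>y. indicator (ball 0 (\<rho>/2)) (y::real^'n) *\<^sub>R ?c \<partial>lborel) \<le> (\<integral>y. bump \<rho> (y::real^'n) \<partial>lborel)"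
  proof (rule integral_mono)
    show "integrable lborel (\<lambda>y. indicator (ball 0 (\<rho>/2)) (y::real^'n) *\<^sub>R ?c)"
      by (intro integrable_scaleR_left integrable_real_indicator)
         (auto simp: emeasure_lborel_ball_finite[unfolded infinity_ennreal_def])
    fix y :: "real^'n"
    show "indicator (ball 0 (\<rho>/2)) y *\<^sub>R ?c \<le> bump \<rho> y"
    proof (cases "y \<in> ball 0 (\<rho>/2)")
      case True
      then have "(norm y)\<^sup>2 \<le> (\<rho>/2)\<^sup>2" by (intro power_mono) auto
      then have "y \<bullet> y \<le> \<rho>\<^sup>2 / 4" by (simp add: power2_norm_eq_inner power_divide)
      then have "\<rho>\<^sup>2 * (3/4) \<le> \<rho>\<^sup>2 - y \<bullet> y" by (simp add: field_simps)
      then have "\<rho>\<^sup>2 * (3/4) \<le> max 0 (\<rho>\<^sup>2 - y \<bullet> y)" by (rule order_trans) simp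
      then have "?c \<le> bump \<rho> y" unfolding bump_def by (intro power_mono) auto
      then show ?thesis using True by simp
    qed (auto simp: bump_nonneg)
  qed (rule int)
  moreover have "measure lborel (ball (0::real^'n) (\<rho>/2)) > 0"
    using assms by (simp add: content_ball_pos)
  moreover have "(\<integral>y. indicator (ball 0 (\<rho>/2)) (y::real^'n) *\<^sub>R ?c \<partial>lborel) =  measure lborel (ball (0::real^'n) (\<rho>/2)) * ?c"
    by simp
  moreover have "?c > 0" using assms by simp
  ultimately show ?thesis by (metis less_le_trans mult_pos_pos)
qed

lemma mollify_shift:
  fixes w :: "real^'n \<Rightarrow> real"
  assumes "continuous_on UNIV w" "\<rho> > 0"
  shows "mollify \<rho> w x = (\<integral>z. bump \<rho> z * w (x + z) \<partial>lborel) / (\<integral>y. bump \<rho> (y::real^'n) \<partial>lborel)"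
  using bump_shift(2)[OF assms(1), of \<rho>] assms(2) by (simp add: mollify_def)

lemma mollify_periodic:
  fixes w :: "real^'n \<Rightarrow> real"
  assumes "continuous_on UNIV w" "periodic_fun w" "\<rho> > 0"
  shows "periodic_fun (mollify \<rho> w)"
proof -
  have "w (x + k + z) = w (x + z)" if "int_vec k" for x k z
    using assms(2) that unfolding periodic_fun_def by (metis add.commute add.left_commute)
  then show ?thesis
    unfolding periodic_fun_def mollify_shift[OF assms(1,3)] by simp
qed

text \<open>A mollification is an average of translates, so it inherits every bound on increments that
  holds uniformly on the support of the kernel.\<close>

lemma mollify_diff_le:
  fixes w v :: "real^'n \<Rightarrow> real"
  assumes w: "continuous_on UNIV w" and v: "continuous_on UNIV v" and \<rho>: "\<rho> > 0"
    and le: "\<And>z. norm z < \<rho> \<Longrightarrow> w (x + z) - v (x' + z) \<le> s"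
  shows "mollify \<rho> w x - mollify \<rho> v x' \<le> s"
proof -
  let ?c = "\<integral>y. bump \<rho> (y::real^'n) \<partial>lborel"
  have c: "?c > 0" by (rule bump_mass_pos[OF \<rho>])
  have "(\<integral>z. bump \<rho> z * w (x + z) \<partial>lborel) - (\<integral>z. bump \<rho> z * v (x' + z) \<partial>lborel)
       = (\<integral>z. bump \<rho> z * w (x + z) - bump \<rho> z * v (x' + z) \<partial>lborel)"
    using \<rho> by (intro Bochner_Integration.integral_diff[symmetric] bump_shift w v) auto
  also have "\<dots> \<le> (\<integral>z. bump \<rho> (z::real^'n) * s \<partial>lborel)"
  proof (rule integral_mono)
    show "integrable lborel (\<lambda>z. bump \<rho> z * w (x + z) - bump \<rho> z * v (x' + z))"
      using \<rho> by (intro Bochner_Integration.integrable_diff bump_shift w v) auto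
    show "integrable lborel (\<lambda>z::real^'n. bump \<rho> z * s)"
      using bump_shift(1)[of "\<lambda>_. s" \<rho> 0] \<rho> by simp
    fix z :: "real^'n"
    show "bump \<rho> z * w (x + z) - bump \<rho> z * v (x' + z) \<le> bump \<rho> z * s"
      using le[of z] bump_nonneg[of \<rho> z] bump_outside[of \<rho> z] \<rho>
      by (cases "norm z < \<rho>") (auto simp: right_diff_distrib[symmetric] mult_left_mono)
  qed
  also have "\<dots> = ?c * s" by simp
  finally show ?thesis
    using c unfolding mollify_shift[OF w \<rho>] mollify_shift[OF v \<rho>]
    by (simp add: diff_divide_distrib[symmetric] divide_le_eq mult.commute)
qed

text \<open>The variable \<open>x\<close> occurs only in the kernel, so differentiation under the
  integral sign applies, locally around each \<open>x0\<close> over a fixed box.\<close>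

lemma mollify_C1:
  fixes w :: "real^'n \<Rightarrow> real"
  assumes w: "continuous_on UNIV w" and \<rho>: "\<rho> > 0"
  shows "C1_fun (mollify \<rho> w)"
proof -
  let ?c = "\<integral>y. bump \<rho> (y::real^'n) \<partial>lborel"
  \<comment> \<open>\<open>k\<close> is minus the gradient of \<open>bump \<rho>\<close>; the sign
    comes from differentiating \<open>bump \<rho> (y - x)\<close> in \<open>x\<close>.\<close>
  define k :: "real^'n \<Rightarrow> real^'n" where "k z = (4 * max 0 (\<rho>\<^sup>2 - z \<bullet> z)) *\<^sub>R z" for z
  have der: "((\<lambda>x. bump \<rho> (y - x)) has_derivative (\<lambda>h. k (y - x) \<bullet> h)) (at x)" for x y :: "real^'n"
  proof -
    have "((\<lambda>x. \<rho>\<^sup>2 - (y - x) \<bullet> (y - x)) has_derivative (\<lambda>h. 2 * ((y - x) \<bullet> h))) (at x)"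
      by (auto intro!: derivative_eq_intros simp: inner_commute)
    from has_derivative_compose[OF this has_derivative_pos_part_sq[unfolded has_field_derivative_def]]
    show ?thesis by (simp add: bump_def k_def mult_ac)
  qed
  have k0: "k z = 0" if "norm z \<ge> \<rho>" for z
    using that \<rho> power_mono[of \<rho> "norm z" 2] by (simp add: k_def power2_norm_eq_inner)
  define G where "G x = integral UNIV (\<lambda>y. w y *\<^sub>R k (y - x))" for x
  have loc: "((\<lambda>x. \<integral>y. bump \<rho> (y - x) * w y \<partial>lborel) has_derivative (\<lambda>h. G x0 \<bullet> h)) (at x0) \<and> isCont G x0" for x0
  proof -
    \<comment> \<open>The box contains the supports of all kernels centred within distance 1 of
      \<open>x0\<close>, so the domain of integration does not depend on \<open>x\<close>.\<close>
    obtain a where ab: "cball x0 (1 + \<rho>) \<subseteq> cbox (-a) a"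
      by (metis bounded_cball bounded_subset_cbox_symmetric)
    have out: "norm (y - x) \<ge> \<rho>" if "x \<in> ball x0 1" "y \<notin> cbox (-a) a" for x y
    proof (rule ccontr)
      assume "\<not> ?thesis"
      then have "dist x0 y \<le> 1 + \<rho>"
        using that(1) dist_triangle[of x0 y x] by (auto simp: dist_norm norm_minus_commute)
      then show False using ab that(2) by auto
    qed
    have F: "(\<integral>y. bump \<rho> (y - x) * w y \<partial>lborel) = integral (cbox (-a) a) (\<lambda>y. bump \<rho> (y - x) * w y)"
      if x: "x \<in> ball x0 1" for x
    proof -
      have "(\<integral>y. bump \<rho> (y - x) * w y \<partial>lborel) = integral UNIV (\<lambda>y. bump \<rho> (y - x) * w y)"
        using integral_lborel[OF integrable_bump[OF w, of \<rho> x]] \<rho> by simp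
      also have "\<dots> = integral (cbox (-a) a) (\<lambda>y. bump \<rho> (y - x) * w y)"
        by (rule integral_spike_set; rule negligible_subset[OF negligible_empty];
            use out[OF x] bump_outside[of \<rho>] \<rho> in force)
      finally show ?thesis .
    qed
    have GF: "G x = integral (cbox (-a) a) (\<lambda>y. w y *\<^sub>R k (y - x))" if x: "x \<in> ball x0 1" for x
      unfolding G_def
      by (rule integral_spike_set; rule negligible_subset[OF negligible_empty];
            use out[OF x] k0 in force)
    have contk: "continuous_on (ball x0 1 \<times> cbox (-a) a) (\<lambda>(x, y). w y *\<^sub>R k (y - x))"
      unfolding k_def split_beta
      by (intro continuous_intros continuous_on_compose2[OF w]) auto
    have contG: "continuous_on (ball x0 1) (\<lambda>x. integral (cbox (-a) a) (\<lambda>y. w y *\<^sub>R k (y - x)))"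
      by (rule integral_continuous_on_param[OF contk])
    have "continuous_on (ball x0 1) G"
      using contG by (rule continuous_on_eq) (simp add: GF)
    then have "isCont G x0" by (simp add: continuous_on_eq_continuous_at)
    moreover have "((\<lambda>x. integral (cbox (-a) a) (\<lambda>y. bump \<rho> (y - x) * w y)) has_derivative
        blinfun_apply (integral (cbox (-a) a) (\<lambda>y. blinfun_inner_right (w y *\<^sub>R k (y - x0))))) (at x0 within ball x0 1)"
    proof (rule leibniz_rule)
      fix x y assume "x \<in> ball x0 1" "y \<in> cbox (-a) a"
      show "((\<lambda>x. bump \<rho> (y - x) * w y) has_derivative
            blinfun_apply (blinfun_inner_right (w y *\<^sub>R k (y - x)))) (at x within ball x0 1)"
        by (rule has_derivative_at_withinI) (auto intro!: derivative_eq_intros der simp: fun_eq_iff)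
    next
      fix x assume "x \<in> ball x0 1"
      show "(\<lambda>y. bump \<rho> (y - x) * w y) integrable_on cbox (-a) a"
        by (intro integrable_continuous continuous_intros continuous_bump continuous_on_subset[OF w]) auto
    next
      show "continuous_on (ball x0 1 \<times> cbox (-a) a) (\<lambda>(x, y). blinfun_inner_right (w y *\<^sub>R k (y - x)))"
        using bounded_linear.continuous_on[OF bounded_linear_blinfun_inner_right contk]
        by (simp add: split_beta)
    qed auto
    moreover have "blinfun_apply (integral (cbox (-a) a) (\<lambda>y. blinfun_inner_right (w y *\<^sub>R k (y - x0)))) = (\<lambda>h. G x0 \<bullet> h)"
    proof -
      have i1: "(\<lambda>y. w y *\<^sub>R k (y - x0)) integrable_on cbox (-a) a"
        unfolding k_def by (intro integrable_continuous continuous_intros continuous_on_subset[OF w]) auto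
      have "integral (cbox (-a) a) (\<lambda>y. blinfun_inner_right (w y *\<^sub>R k (y - x0)))
          = blinfun_inner_right (integral (cbox (-a) a) (\<lambda>y. w y *\<^sub>R k (y - x0)))"
        using integral_linear[OF i1 bounded_linear_blinfun_inner_right] by (simp add: o_def)
      then show ?thesis by (simp add: GF)
    qed
    ultimately have 1: "((\<lambda>x. integral (cbox (-a) a) (\<lambda>y. bump \<rho> (y - x) * w y)) has_derivative (\<lambda>h. G x0 \<bullet> h)) (at x0)"
      by (simp add: at_within_open[of x0 "ball x0 1"])
    have "((\<lambda>x. \<integral>y. bump \<rho> (y - x) * w y \<partial>lborel) has_derivative (\<lambda>h. G x0 \<bullet> h)) (at x0)"
      by (rule has_derivative_transform_within_open[OF 1, of "ball x0 1"]) (auto simp: F)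
    then show ?thesis using \<open>isCont G x0\<close> by blast
  qed
  have "(mollify \<rho> w has_derivative (\<lambda>h. (G x /\<^sub>R ?c) \<bullet> h)) (at x)" for x
    unfolding mollify_def[abs_def] using bump_mass_pos[OF \<rho>, where 'n = 'n] loc[of x, THEN conjunct1]
    by (auto intro!: derivative_eq_intros simp: field_simps)
  moreover have "continuous_on UNIV (\<lambda>x. G x /\<^sub>R ?c)"
    using loc by (intro continuous_intros continuous_at_imp_continuous_on) auto
  ultimately show ?thesis by (rule C1_funI(1)[rotated])
qed


section \<open>Hamiltonian and Lagrangian\<close>

lemma has_derivative_imp_continuous_on:
  assumes "\<And>x. (f has_derivative f' x) (at x)"
  shows "continuous_on UNIV f"
  using assms by (meson continuous_at_imp_continuous_on has_derivative_continuous)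

text \<open>An integer translation brings \<open>x\<close> into the cube; capping the distance at 1
  keeps the translated \<open>y\<close> in a compact neighbourhood of it, where ordinary uniform
  continuity applies.\<close>

lemma periodic_uniformly_continuous:
  fixes F :: "real^'n \<Rightarrow> 'c::metric_space \<Rightarrow> 'b::metric_space"
  assumes cont: "continuous_on (UNIV \<times> C) (\<lambda>z. F (fst z) (snd z))" and C: "compact C"
    and per: "\<And>x p k. int_vec k \<Longrightarrow> F (x + k) p = F x p" and e: "e > 0"
  obtains r where "r > 0" "\<And>x y p. p \<in> C \<Longrightarrow> dist x y < r \<Longrightarrow> dist (F x p) (F y p) < e"
proof -
  obtain R where R: "\<And>x::real^'n. x \<in> unit_cube \<Longrightarrow> norm x \<le> R"
    using compact_imp_bounded[OF compact_unit_cube] unfolding bounded_iff by metis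
  let ?K = "cball (0::real^'n) (R + 1) \<times> C"
  have "uniformly_continuous_on ?K (\<lambda>z. F (fst z) (snd z))"
    by (rule compact_uniformly_continuous)
       (use C cont in \<open>auto intro: compact_Times continuous_on_subset\<close>)
  then obtain d where d: "d > 0" "\<And>z z'. z \<in> ?K \<Longrightarrow> z' \<in> ?K \<Longrightarrow> dist z' z < d \<Longrightarrow>
      dist (F (fst z') (snd z')) (F (fst z) (snd z)) < e"
    using e unfolding uniformly_continuous_on_def by metis
  show thesis
  proof (rule that[of "min d 1"])
    show "min d 1 > 0" using d by simp
    fix x y :: "real^'n" and p assume p: "p \<in> C" and xy: "dist x y < min d 1"
    obtain k where k: "int_vec k" "frac_vec x = x + k" using frac_vec_eq_add_int_vec by blast
    have x: "norm (x + k) \<le> R" using R[OF frac_vec_cube[of x]] k by simp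
    moreover have xy': "dist (x + k) (y + k) < min d 1" using xy by (simp add: dist_norm)
    ultimately have y: "norm (y + k) \<le> R + 1"
      using norm_triangle_sub[of "y + k" "x + k"] by (simp add: dist_norm norm_minus_commute)
    have "dist (F (x + k) p) (F (y + k) p) < e"
      using d(2)[of "(y + k, p)" "(x + k, p)"] p x y xy'
      by (simp add: dist_Pair_Pair)
    then show "dist (F x p) (F y p) < e" using per k by simp
  qed
qed

lemma hamiltonian_periodic: "hamiltonian_ok H \<Longrightarrow> int_vec k \<Longrightarrow> H (x + k) = H x"
  by (auto simp: hamiltonian_ok_def fun_eq_iff)

lemma hamiltonian_convex: "hamiltonian_ok H \<Longrightarrow> convex_on UNIV (H x)"
  by (auto simp: hamiltonian_ok_def)

lemma hamiltonian_coercive: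
  fixes H :: "real^'n \<Rightarrow> real^'n \<Rightarrow> real"
  assumes "hamiltonian_ok H"
  obtains P where "P > 0" "\<And>x p. norm p \<ge> P \<Longrightarrow> H x p \<ge> M"
proof -
  obtain R where R: "\<And>x p. norm p \<ge> R \<Longrightarrow> H x p \<ge> \<bar>M\<bar> * norm p"
    using assms unfolding hamiltonian_ok_def by blast
  show thesis
  proof (rule that[of "max R 1"])
    fix x p :: "real^'n" assume p: "norm p \<ge> max R 1"
    have "\<bar>M\<bar> * 1 \<le> \<bar>M\<bar> * norm p" using p by (intro mult_left_mono) auto
    then show "H x p \<ge> M" using R[of p x] p by simp
  qed simp
qed

text \<open>Joint continuity in position and momentum is what makes velocity and action continuous
  on phase space.\<close>

lemma hamiltonian_C1:
  fixes H :: "real^'n \<Rightarrow> real^'n \<Rightarrow> real"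
  assumes "hamiltonian_ok H"
  shows hamiltonian_continuous: "continuous_on UNIV (\<lambda>z. H (fst z) (snd z))"
    and hamiltonian_grad_continuous: "continuous_on UNIV (\<lambda>z. grad (H (fst z)) (snd z))"
    and hamiltonian_has_derivative: "(H x has_derivative (\<lambda>h. grad (H x) p \<bullet> h)) (at p)"
proof -
  obtain D D2 where D: "\<And>z. ((\<lambda>(x, p). H x p) has_derivative blinfun_apply (D z)) (at z)"
      "\<And>z. (D has_derivative blinfun_apply (D2 z)) (at z)"
    using assms unfolding hamiltonian_ok_def C2_fun_def by blast
  show "continuous_on UNIV (\<lambda>z. H (fst z) (snd z))"
    using has_derivative_imp_continuous_on[OF D(1)] by (simp add: split_beta)
  have Dc: "continuous_on UNIV D"
    using D(2) by (rule has_derivative_imp_continuous_on)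
  define g where "g x p = (\<chi> i. blinfun_apply (D (x, p)) (0, axis i 1))" for x p
  have der: "(H x has_derivative (\<lambda>h. g x p \<bullet> h)) (at p)" for x p
  proof -
    have "((\<lambda>p. (x, p)) has_derivative (\<lambda>h. (0, h))) (at p)"
      by (auto intro!: derivative_eq_intros)
    from has_derivative_compose[OF this D(1)]
    have 1: "(H x has_derivative (\<lambda>h. blinfun_apply (D (x, p)) (0, h))) (at p)" by simp
    have "blinfun_apply (D (x, p)) (0, h) = g x p \<bullet> h" for h
    proof -
      have lin: "linear (\<lambda>h. blinfun_apply (D (x, p)) (0, h))"
        using 1 has_derivative_linear by blast
      have "blinfun_apply (D (x, p)) (0, h) = blinfun_apply (D (x, p)) (0, \<Sum>i\<in>UNIV. h $ i *\<^sub>R axis i 1)"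
        by (simp add: basis_expansion scalar_mult_eq_scaleR[symmetric])
      also have "\<dots> = (\<Sum>i\<in>UNIV. h $ i * blinfun_apply (D (x, p)) (0, axis i 1))"
        using linear_sum[OF lin, of "\<lambda>i. h $ i *\<^sub>R axis i 1" UNIV] linear_cmul[OF lin] by simp
      finally show ?thesis by (simp add: g_def inner_vec_def mult.commute)
    qed
    with 1 show ?thesis by simp
  qed
  have g: "grad (H x) p = g x p" for x p using der by (rule grad_eqI)
  show "(H x has_derivative (\<lambda>h. grad (H x) p \<bullet> h)) (at p)" using der by (simp add: g)
  show "continuous_on UNIV (\<lambda>z. grad (H (fst z)) (snd z))"
    unfolding g g_def by (intro continuous_intros continuous_on_vec_lambda) (auto intro: Dc)
qed

lemma hamiltonian_tangent:
  fixes H :: "real^'n \<Rightarrow> real^'n \<Rightarrow> real"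
  assumes "hamiltonian_ok H"
  shows "H x p + grad (H x) p \<bullet> (q - p) \<le> H x q"
proof -
  let ?g = "\<lambda>t. H x (p + t *\<^sub>R (q - p))"
  have "convex_on UNIV ?g"
  proof (rule convex_onI)
    fix t a b :: real assume "0 < t" "t < 1"
    then have "H x ((1 - t) *\<^sub>R (p + a *\<^sub>R (q - p)) + t *\<^sub>R (p + b *\<^sub>R (q - p)))
        \<le> (1 - t) * H x (p + a *\<^sub>R (q - p)) + t * H x (p + b *\<^sub>R (q - p))"
      by (intro convex_onD[OF hamiltonian_convex[OF assms]]) auto
    moreover have "(1 - t) *\<^sub>R (p + a *\<^sub>R (q - p)) + t *\<^sub>R (p + b *\<^sub>R (q - p))
        = p + ((1 - t) *\<^sub>R a + t *\<^sub>R b) *\<^sub>R (q - p)" by (simp add: algebra_simps)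
    ultimately show "?g ((1 - t) *\<^sub>R a + t *\<^sub>R b) \<le> (1 - t) * ?g a + t * ?g b" by simp
  qed simp
  moreover have "(?g has_field_derivative (grad (H x) p \<bullet> (q - p))) (at 0 within UNIV)"
  proof -
    have "((\<lambda>t. p + t *\<^sub>R (q - p)) has_derivative (\<lambda>t. t *\<^sub>R (q - p))) (at 0)"
      by (auto intro!: derivative_eq_intros)
    from has_derivative_compose[OF this, of "H x" "\<lambda>h. grad (H x) p \<bullet> h"]
    show ?thesis using hamiltonian_has_derivative[OF assms, of x p]
      by (simp add: has_field_derivative_def mult_commute_abs)
  qed
  ultimately have "?g 1 - ?g 0 \<ge> (grad (H x) p \<bullet> (q - p)) * (1 - 0)"
    by (intro convex_on_imp_above_tangent[where A = UNIV]) auto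
  then show ?thesis by simp
qed

text \<open>A real \<open>SUP\<close> is an upper bound only of a family bounded above. Superlinear
  growth with slope \<open>norm v\<close> bounds the family outside a ball, compactness
  inside.\<close>

lemma lagrangian_ge:
  fixes H :: "real^'n \<Rightarrow> real^'n \<Rightarrow> real"
  assumes "hamiltonian_ok H"
  shows "q \<bullet> v - H x q \<le> lagrangian H x v"
proof -
  obtain R where R: "\<And>x p. norm p \<ge> R \<Longrightarrow> H x p \<ge> norm v * norm p"
    using assms unfolding hamiltonian_ok_def by blast
  have c: "continuous_on UNIV (H x)"
    using hamiltonian_has_derivative[OF assms] by (rule has_derivative_imp_continuous_on)
  have "compact ((\<lambda>p. p \<bullet> v - H x p) ` cball 0 R)"
    by (intro compact_continuous_image continuous_intros continuous_on_subset[OF c]) auto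
  then have "bdd_above ((\<lambda>p. p \<bullet> v - H x p) ` cball 0 R)"
    by (intro bounded_imp_bdd_above compact_imp_bounded)
  then obtain b where "\<forall>y\<in>(\<lambda>p. p \<bullet> v - H x p) ` cball 0 R. y \<le> b"
    unfolding bdd_above_def by blast
  then have b: "p \<bullet> v - H x p \<le> b" if "norm p \<le> R" for p using that by simp
  have "p \<bullet> v - H x p \<le> max b 0" for p
  proof (cases "norm p \<le> R")
    case False
    have "p \<bullet> v \<le> norm v * norm p" using norm_cauchy_schwarz[of p v] by (simp add: mult.commute)
    with R[of p x] False show ?thesis by simp
  qed (use b in \<open>auto simp: le_max_iff_disj\<close>)
  then show ?thesis unfolding lagrangian_def by (intro cSUP_upper bdd_aboveI2) auto
qed

text \<open>Equality case of the Fenchel inequality: at the velocity \<open>grad (H x) p\<close> the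
  tangent inequality says that \<open>p\<close> attains the supremum.\<close>

lemma lagrangian_grad:
  fixes H :: "real^'n \<Rightarrow> real^'n \<Rightarrow> real"
  assumes "hamiltonian_ok H"
  shows "lagrangian H x (grad (H x) p) = p \<bullet> grad (H x) p - H x p"
proof (rule antisym)
  show "lagrangian H x (grad (H x) p) \<le> p \<bullet> grad (H x) p - H x p"
    unfolding lagrangian_def
  proof (rule cSUP_least)
    fix q show "q \<bullet> grad (H x) p - H x q \<le> p \<bullet> grad (H x) p - H x p"
      using hamiltonian_tangent[OF assms, of x p q] by (simp add: inner_commute[of "grad (H x) p"] inner_diff_left)
  qed simp
qed (rule lagrangian_ge[OF assms])

section \<open>Smooth approximate subsolutions and comparison\<close>

text \<open>Freeze the position at \<open>x0\<close>. Near \<open>x0\<close> every test gradient of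
  \<open>w\<close> lies in the closed convex set \<open>{p. H x0 p \<le> \<eta>}\<close>. A gradient
  of \<open>\<phi>\<close> outside it would be cut off by a hyperplane with normal \<open>h\<close>,
  but \<open>w\<close>, and hence its average \<open>\<phi>\<close>, cannot grow along
  \<open>h\<close> faster than the hyperplane allows.\<close>

lemma smooth_subsolution:
  fixes H :: "real^'n \<Rightarrow> real^'n \<Rightarrow> real"
  assumes H: "hamiltonian_ok H" and w: "continuous_on UNIV w" "periodic_fun w"
    and sub: "visc_subsol H 0 w" and \<eta>: "\<eta> > 0"
  obtains \<phi> where "C1_fun \<phi>" "periodic_fun \<phi>" "\<And>x. \<bar>\<phi> x - w x\<bar> \<le> \<eta>" "\<And>x. H x (grad \<phi> x) \<le> \<eta>"
proof -
  obtain B where B: "\<And>z. \<bar>w z\<bar> \<le> B" using periodic_bounded[OF w] by metis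
  \<comment> \<open>Test gradients satisfy \<open>H \<le> 0\<close>, so they have norm below
    \<open>P\<close>; the modulus of \<open>H\<close> in the position is needed only on this
    ball.\<close>
  obtain P where P: "P > 0" "\<And>x p. norm p \<ge> P \<Longrightarrow> H x p \<ge> 1" using hamiltonian_coercive[OF H] by metis
  obtain r where r: "r > 0" "\<And>x y p. p \<in> cball 0 P \<Longrightarrow> dist x y < r \<Longrightarrow> dist (H x p) (H y p) < \<eta>"
    by (rule periodic_uniformly_continuous[of "cball 0 P" H \<eta>])
       (use hamiltonian_continuous[OF H] hamiltonian_periodic[OF H] \<eta> in
         \<open>auto intro: continuous_on_subset\<close>)
  obtain r' where r': "r' > 0" "\<And>x y. dist x y < r' \<Longrightarrow> \<bar>w x - w y\<bar> < \<eta>"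
  proof (rule periodic_uniformly_continuous[of "{0::real}" "\<lambda>x _. w x" \<eta>])
    show "continuous_on (UNIV \<times> {0::real}) (\<lambda>z. w (fst z))"
      by (rule continuous_on_compose2[OF w(1)]) (auto intro: continuous_intros)
  qed (use w \<eta> in \<open>auto simp: periodic_fun_def dist_real_def\<close>)
  \<comment> \<open>\<open>r / 2\<close> covers the translation by \<open>z\<close>, leaving
    \<open>r / 2\<close> for the ball in which \<open>viscosity_increment\<close> looks for contact
    points; \<open>r'\<close> controls \<open>\<phi> - w\<close>.\<close>
  define \<rho> where "\<rho> = min (r / 2) r'"
  have \<rho>: "\<rho> > 0" using r r' by (simp add: \<rho>_def)
  define \<phi> where "\<phi> = mollify \<rho> w"
  have C1: "C1_fun \<phi>" unfolding \<phi>_def by (rule mollify_C1[OF w(1) \<rho>])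
  have close: "\<bar>\<phi> x - w x\<bar> \<le> \<eta>" for x
  proof -
    have const: "mollify \<rho> (\<lambda>_. w x) x = w x"
      using bump_mass_pos[OF \<rho>, where 'n = 'n] \<rho> by (subst mollify_shift) auto
    have near: "\<bar>w (x + z) - w x\<bar> \<le> \<eta>" if "norm z < \<rho>" for z
      using that r'(2)[of "x + z" x] by (simp add: \<rho>_def dist_norm less_imp_le)
    have "mollify \<rho> w x - mollify \<rho> (\<lambda>_. w x) x \<le> \<eta>"
      by (rule mollify_diff_le[OF w(1) _ \<rho>]) (use near in \<open>auto simp: abs_le_iff\<close>)
    moreover have "mollify \<rho> (\<lambda>_. w x) x - mollify \<rho> w x \<le> \<eta>"
      by (rule mollify_diff_le[OF _ w(1) \<rho>]) (use near in \<open>auto simp: abs_le_iff\<close>)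
    ultimately show ?thesis by (simp add: const \<phi>_def abs_le_iff)
  qed
  have "H x0 (grad \<phi> x0) \<le> \<eta>" for x0
  proof (rule ccontr)
    define q where "q = grad \<phi> x0"
    define S where "S = {p. H x0 p \<le> \<eta>}"
    assume "\<not> H x0 (grad \<phi> x0) \<le> \<eta>"
    then have qS: "q \<notin> S" by (simp add: q_def S_def)
    have "continuous_on UNIV (H x0)"
      using hamiltonian_has_derivative[OF H] by (rule has_derivative_imp_continuous_on)
    then have "closed S" unfolding S_def by (intro closed_Collect_le continuous_intros)
    moreover have "convex S"
    proof (rule convexI)
      fix p q :: "real^'n" and u v :: real
      assume pq: "p \<in> S" "q \<in> S" and uv: "0 \<le> u" "0 \<le> v" "u + v = 1"
      have "H x0 (u *\<^sub>R p + v *\<^sub>R q) \<le> u * H x0 p + v * H x0 q"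
        using hamiltonian_convex[OF H, of x0] uv unfolding convex_on_def by simp
      also have "\<dots> \<le> \<eta>" using pq uv by (intro convex_bound_le) (auto simp: S_def)
      finally show "u *\<^sub>R p + v *\<^sub>R q \<in> S" by (simp add: S_def)
    qed
    ultimately obtain a b where ab: "a \<bullet> q < b" "\<And>p. p \<in> S \<Longrightarrow> a \<bullet> p > b"
      using separating_hyperplane_closed_point[OF _ _ qS] by metis
    obtain h s where h: "h \<noteq> 0" "q \<bullet> h > s" "\<And>p. p \<in> S \<Longrightarrow> p \<bullet> h \<le> s"
    \<comment> \<open>The separation theorem may return a zero normal when \<open>S\<close> is
      empty; then any direction, with any \<open>s\<close> below \<open>q \<bullet> h\<close>, will
      do.\<close>
    proof (cases "a = 0")
      case True
      then have "S = {}" using ab by force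
      then show thesis using that[of "axis undefined 1" "q \<bullet> axis undefined 1 - 1"] by (auto simp: axis_eq_0_iff)
    next
      case False
      then show thesis using that[of "- a" "- b"] ab by (auto simp: inner_commute less_imp_le)
    qed
    have inc: "\<phi> (x0 + t *\<^sub>R h) - \<phi> x0 \<le> t * s" if t: "t > 0" "2 * (t * norm h) < r / 2" for t
      unfolding \<phi>_def
    proof (rule mollify_diff_le[OF w(1) w(1) \<rho>])
      fix z :: "real^'n" assume z: "norm z < \<rho>"
      have "w ((x0 + z) + t *\<^sub>R h) - w (x0 + z) \<le> t * s"
      proof (rule viscosity_increment[OF w(1) B])
        show "t *\<^sub>R h \<noteq> 0" using t h by simp
        fix \<psi> u assume \<psi>: "C1_fun \<psi>" and u: "u \<in> ball (x0 + z) (2 * norm (t *\<^sub>R h))"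
          and touch: "\<exists>r>0. \<forall>v\<in>ball u r. w v - \<psi> v \<le> w u - \<psi> u"
        have H0: "H u (grad \<psi> u) \<le> 0" using sub \<psi> touch unfolding visc_subsol_def by blast
        then have small: "norm (grad \<psi> u) \<le> P" using P(2)[of "grad \<psi> u" u] by linarith
        have "dist u x0 < r"
        proof -
          have "dist u x0 \<le> dist (x0 + z) u + norm z"
            using dist_triangle[of u x0 "x0 + z"] by (simp add: dist_norm norm_minus_commute)
          then show ?thesis using u z t by (simp add: \<rho>_def)
        qed
        then have "H x0 (grad \<psi> u) \<le> \<eta>"
          using r(2)[of "grad \<psi> u" u x0] small H0 by (simp add: dist_real_def)
        then have "grad \<psi> u \<bullet> h \<le> s" using h(3) by (simp add: S_def)
        then show "grad \<psi> u \<bullet> (t *\<^sub>R h) \<le> t * s" using t by simp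
      qed
      then show "w (x0 + t *\<^sub>R h + z) - w (x0 + z) \<le> t * s" by (simp add: add_ac)
    qed
    have "((\<lambda>t. \<phi> (x0 + t *\<^sub>R h) - t * s) has_real_derivative (q \<bullet> h - s)) (at 0)"
    proof -
      have "((\<lambda>t. x0 + t *\<^sub>R h) has_derivative (\<lambda>t. t *\<^sub>R h)) (at 0)"
        by (auto intro!: derivative_eq_intros)
      from has_derivative_compose[OF this, of \<phi> "\<lambda>h. q \<bullet> h"]
      have "((\<lambda>t. \<phi> (x0 + t *\<^sub>R h)) has_real_derivative (q \<bullet> h)) (at 0)"
        using C1_funE(2)[OF C1, of x0]
        by (simp add: has_field_derivative_def q_def mult_commute_abs)
      then show ?thesis by (auto intro!: derivative_eq_intros)
    qed
    from DERIV_pos_inc_right[OF this] h(2)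
    obtain d where d: "d > 0" "\<And>t. 0 < t \<Longrightarrow> t < d \<Longrightarrow> \<phi> x0 < \<phi> (x0 + t *\<^sub>R h) - t * s"
      by auto
    \<comment> \<open>Small enough for the growth of \<open>\<phi>\<close> at \<open>d\<close>, and
      giving \<open>2 * (t * norm h) \<le> r / 4\<close>, within the range of
      \<open>inc\<close>.\<close>
    define t where "t = min (d / 2) (r / (8 * norm h))"
    have "t > 0" "t < d" using d(1) r(1) h(1) by (auto simp: t_def)
    moreover have "t * norm h \<le> r / 8"
    proof -
      have "t * norm h \<le> (r / (8 * norm h)) * norm h" by (intro mult_right_mono) (auto simp: t_def)
      then show ?thesis using h(1) by simp
    qed
    ultimately show False using inc[of t] d(2)[of t] r(1) by linarith
  qed
  then show thesis using that C1 close mollify_periodic[OF w \<rho>] unfolding \<phi>_def by blast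
qed

text \<open>The smooth function \<open>t \<psi> + (1 - t) \<phi>\<close>, with \<open>\<phi>\<close> a smoothed \<open>w1\<close>, is tested against \<open>w2\<close>: as
  \<open>t\<close> tends to 0 the contact points approach the minimum set of \<open>w2 - w1\<close>, where the right-hand
  side \<open>w2 - w1 - m\<close> vanishes.\<close>

lemma no_strict_subsolution:
  fixes H :: "real^'n \<Rightarrow> real^'n \<Rightarrow> real"
  assumes H: "hamiltonian_ok H" and w1: "visc_sol H 0 w1" and w2: "visc_sol H 0 w2"
    and m: "\<And>x. m \<le> w2 x - w1 x" "w2 x0 - w1 x0 = m"
    and \<psi>: "C1_fun \<psi>" "periodic_fun \<psi>"
  shows "\<exists>x. w2 x - w1 x - m \<le> H x (grad \<psi> x)"
proof (rule ccontr)
  let ?f = "\<lambda>x. w2 x - w1 x - m"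
  assume "\<not> ?thesis"
  then have neg: "H x (grad \<psi> x) - ?f x < 0" for x by (simp add: not_le)
  have w1': "continuous_on UNIV w1" "periodic_fun w1" "visc_subsol H 0 w1"
    and w2': "continuous_on UNIV w2" "periodic_fun w2" "visc_supersol H 0 w2"
    using w1 w2 by (auto simp: visc_sol_def)
  have Hc: "continuous_on UNIV (\<lambda>x. H x (grad \<psi> x))"
    using continuous_on_compose2[OF hamiltonian_continuous[OF H], of UNIV "\<lambda>x. (x, grad \<psi> x)"]
      continuous_on_Pair[OF continuous_on_id C1_funE(1)[OF \<psi>(1)]] by simp
  have "continuous_on UNIV (\<lambda>x. H x (grad \<psi> x) - ?f x)"
    by (intro continuous_intros Hc w1' w2')
  moreover have "periodic_fun (\<lambda>x. H x (grad \<psi> x) - ?f x)"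
    using periodic_grad[OF \<psi>] w1'(2) w2'(2) hamiltonian_periodic[OF H]
    by (simp add: periodic_fun_def)
  ultimately have "\<exists>y. \<forall>x. H x (grad \<psi> x) - ?f x \<le> H y (grad \<psi> y) - ?f y"
    by (rule periodic_attains_sup)
  then obtain y where y: "\<And>x. H x (grad \<psi> x) - ?f x \<le> H y (grad \<psi> y) - ?f y" by blast
  \<comment> \<open>By compactness the strict inequality holds with a uniform gap.\<close>
  define \<epsilon> where "\<epsilon> = - (H y (grad \<psi> y) - ?f y)"
  have \<epsilon>: "\<epsilon> > 0" "\<And>x. H x (grad \<psi> x) \<le> ?f x - \<epsilon>"
    using neg[of y] y by (auto simp: \<epsilon>_def algebra_simps)
  obtain B where B: "B > 0" "\<And>x. \<bar>\<psi> x\<bar> \<le> B"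
    using periodic_bounded[OF C1_fun_continuous[OF \<psi>(1)] \<psi>(2)] by metis
  obtain B1 where B1: "B1 > 0" "\<And>x. \<bar>w1 x\<bar> \<le> B1" using periodic_bounded[OF w1'(1,2)] by metis
  define C where "C = B + B1 + 1"
  \<comment> \<open>A single small \<open>t\<close> replaces the limit: it makes
    \<open>t * (2 * C + \<epsilon>)\<close> equal to \<open>\<epsilon> / 4\<close>, below the lower
    bound \<open>\<epsilon> / 2\<close> for \<open>?f z\<close> found at the contact point.\<close>
  define t where "t = \<epsilon> / (4 * (2 * C + \<epsilon>))"
  have C: "C > 0" using B B1 by (simp add: C_def)
  have t0: "t > 0" using C \<epsilon>(1) by (simp add: t_def)
  have tJ: "t * (2 * C + \<epsilon>) = \<epsilon> / 4"
    using C \<epsilon>(1) by (simp add: t_def divide_simps)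
  have t1: "t < 1"
  proof (rule ccontr)
    assume "\<not> t < 1"
    have "1 * \<epsilon> \<le> t * (2 * C + \<epsilon>)"
      using \<open>\<not> t < 1\<close> C \<epsilon>(1) by (intro mult_mono) auto
    then show False using tJ \<epsilon>(1) by simp
  qed
  \<comment> \<open>The smoothing error must be small against the gain
    \<open>t * \<epsilon>\<close>; the cap 1 only accounts for the summand 1 in
    \<open>C\<close>.\<close>
  define \<eta> where "\<eta> = min 1 (t * \<epsilon> / 2)"
  have \<eta>: "\<eta> > 0" "\<eta> \<le> 1" "\<eta> \<le> t * \<epsilon> / 2" using t0 \<epsilon> by (auto simp: \<eta>_def)
  obtain \<phi> where \<phi>: "C1_fun \<phi>" "periodic_fun \<phi>" "\<And>x. \<bar>\<phi> x - w1 x\<bar> \<le> \<eta>" "\<And>x. H x (grad \<phi> x) \<le> \<eta>"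
    using smooth_subsolution[OF H w1' \<eta>(1)] by metis
  define u where "u x = t * \<psi> x + (1 - t) * \<phi> x" for x
  have u: "C1_fun u" "grad u = (\<lambda>x. t *\<^sub>R grad \<psi> x + (1 - t) *\<^sub>R grad \<phi> x)"
    unfolding u_def[abs_def] by (rule C1_fun_lincomb[OF \<psi>(1) \<phi>(1)])+
  have "periodic_fun (\<lambda>x. u x - w2 x)"
    using \<psi>(2) \<phi>(2) w2'(2) by (simp add: periodic_fun_def u_def)
  moreover have "continuous_on UNIV (\<lambda>x. u x - w2 x)"
    by (intro continuous_intros C1_fun_continuous u w2')
  ultimately have "\<exists>z. \<forall>x. u x - w2 x \<le> u z - w2 z" by (rule periodic_attains_sup[rotated])
  then obtain z where z: "\<And>x. u x - w2 x \<le> u z - w2 z" by blast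
  \<comment> \<open>At \<open>z\<close> the C1 function \<open>u\<close> touches \<open>w2\<close>
    from below, so it is admissible in the supersolution test.\<close>
  have "0 \<le> H z (grad u z)"
  proof -
    have "\<forall>v\<in>ball z 1. w2 v - u v \<ge> w2 z - u z" using z by (simp add: algebra_simps)
    then show ?thesis using w2'(3) u(1) unfolding visc_supersol_def by (metis zero_less_one)
  qed
  also have "H z (grad u z) = H z ((1 - t) *\<^sub>R grad \<phi> z + t *\<^sub>R grad \<psi> z)" by (simp add: u(2) add.commute)
  also have "\<dots> \<le> (1 - t) * H z (grad \<phi> z) + t * H z (grad \<psi> z)"
    using t0 t1 by (intro convex_onD[OF hamiltonian_convex[OF H]]) auto
  also have "\<dots> \<le> 1 * \<eta> + t * (?f z - \<epsilon>)"
  proof (rule add_mono)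
    have "(1 - t) * H z (grad \<phi> z) \<le> (1 - t) * \<eta>" using t1 \<phi>(4) by (intro mult_left_mono) auto
    also have "\<dots> \<le> 1 * \<eta>" using t0 \<eta> by (intro mult_right_mono) auto
    finally show "(1 - t) * H z (grad \<phi> z) \<le> 1 * \<eta>" .
  qed (use t0 \<epsilon>(2) in \<open>auto intro: mult_left_mono\<close>)
  finally have "t * (\<epsilon> / 2) \<le> t * (?f z)" using \<eta>(3) by (simp add: algebra_simps)
  then have fz: "\<epsilon> / 2 \<le> ?f z" using t0 by (simp only: mult_le_cancel_left_pos)
  have bd: "\<bar>\<psi> x - \<phi> x\<bar> \<le> C" for x
    using B(2)[of x] B1(2)[of x] \<phi>(3)[of x] \<eta>(2) unfolding C_def by linarith
  have ub: "\<bar>u x - w1 x\<bar> \<le> t * C + \<eta>" for x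
  proof -
    have "u x - w1 x = t * (\<psi> x - \<phi> x) + (\<phi> x - w1 x)" by (simp add: u_def algebra_simps)
    moreover have "\<bar>t * (\<psi> x - \<phi> x)\<bar> \<le> t * C" using t0 bd[of x] by (simp add: abs_mult mult_left_mono)
    ultimately show ?thesis using \<phi>(3)[of x] by linarith
  qed
  define K where "K = t * C + \<eta>"
  \<comment> \<open>Comparing the maximum point \<open>z\<close> with the minimum point
    \<open>x0\<close> of \<open>w2 - w1\<close>: \<open>u\<close> differs from \<open>w1\<close> by
    at most \<open>K\<close> at both.\<close>
  have "?f z \<le> 2 * K"
    using z[of x0] ub[of x0, folded K_def] ub[of z, folded K_def] m(2) by linarith
  also have "\<dots> \<le> t * (2 * C + \<epsilon>)" using \<eta>(3) by (simp add: K_def algebra_simps)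
  finally have "?f z \<le> \<epsilon> / 4" using tJ by simp
  then show False using fz \<epsilon>(1) by linarith
qed

text \<open>Integrate the Fenchel inequality at the momentum \<open>grad \<phi> x\<close> of a
  smooth approximate subsolution; the left-hand side vanishes because the measure is
  holonomic.\<close>

lemma holonomic_action_nonneg:
  fixes H :: "real^'n \<Rightarrow> real^'n \<Rightarrow> real"
  assumes H: "hamiltonian_ok H" and w: "visc_sol H 0 w" and \<nu>: "\<nu> \<in> holonomic"
    and int: "integrable \<nu> (\<lambda>(x, v). lagrangian H x v)"
  shows "0 \<le> (\<integral>(x, v). lagrangian H x v \<partial>\<nu>)"
proof (rule field_le_epsilon)
  fix \<eta> :: real assume \<eta>: "\<eta> > 0"
  obtain \<phi> where \<phi>: "C1_fun \<phi>" "periodic_fun \<phi>" "\<And>x. H x (grad \<phi> x) \<le> \<eta>"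
    using smooth_subsolution[OF H _ _ _ \<eta>, of w] w unfolding visc_sol_def by metis
  interpret prob_space \<nu> using \<nu> by (simp add: holonomic_def prob_TR_def)
  have h: "integrable \<nu> (\<lambda>(x, v). v \<bullet> grad \<phi> x)" "(\<integral>(x, v). v \<bullet> grad \<phi> x \<partial>\<nu>) = 0"
    using \<nu> \<phi> by (auto simp: holonomic_def)
  have "(\<integral>z. (case z of (x, v) \<Rightarrow> v \<bullet> grad \<phi> x) \<partial>\<nu>) \<le> (\<integral>z. (case z of (x, v) \<Rightarrow> lagrangian H x v) + \<eta> \<partial>\<nu>)"
  proof (rule integral_mono)
    show "integrable \<nu> (\<lambda>z. (case z of (x, v) \<Rightarrow> lagrangian H x v) + \<eta>)" using int by simp
    fix z :: "(real^'n) \<times> (real^'n)"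
    obtain x v where z: "z = (x, v)" by (cases z)
    show "(case z of (x, v) \<Rightarrow> v \<bullet> grad \<phi> x) \<le> (case z of (x, v) \<Rightarrow> lagrangian H x v) + \<eta>"
      using lagrangian_ge[OF H, of "grad \<phi> x" v x] \<phi>(3)[of x] by (simp add: z inner_commute)
  qed (rule h(1))
  also have "\<dots> = (\<integral>(x, v). lagrangian H x v \<partial>\<nu>) + \<eta>"
    using int by (subst Bochner_Integration.integral_add) (auto simp: prob_space)
  finally show "0 \<le> (\<integral>(x, v). lagrangian H x v \<partial>\<nu>) + \<eta>" using h(2) by simp
qed


section \<open>A finite moment problem\<close>

lemma bernoulli_mixture_expectation:
  fixes h :: "'a \<Rightarrow> real"
  assumes "finite (set_pmf \<kappa>)" "0 \<le> t" "t \<le> 1"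
  shows "measure_pmf.expectation (bernoulli_pmf t \<bind> (\<lambda>b. if b then return_pmf z else \<kappa>)) h
     = measure_pmf.expectation \<kappa> h + t * (h z - measure_pmf.expectation \<kappa> h)"
proof -
  have "measure_pmf.expectation (bernoulli_pmf t \<bind> (\<lambda>b. if b then return_pmf z else \<kappa>)) h
     = (\<Sum>b\<in>UNIV. pmf (bernoulli_pmf t) b *\<^sub>R measure_pmf.expectation (if b then return_pmf z else \<kappa>) h)"
    using assms by (intro pmf_expectation_bind) auto
  then show ?thesis using assms by (simp add: UNIV_bool algebra_simps)
qed

text \<open>First-order expansion with an explicit quadratic remainder, the descent estimate for the
  next minimisation.\<close>

lemma pos_part_sq_add_le:
  fixes e d t :: real
  shows "(max 0 (e + t * d))\<^sup>2 \<le> (max 0 e)\<^sup>2 + 2 * t * (max 0 e * d) + t\<^sup>2 * d\<^sup>2"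
proof -
  have "(max 0 (e + t * d))\<^sup>2 \<le> (max 0 e + t * d)\<^sup>2"
  proof (cases "e + t * d \<le> 0")
    case False
    then show ?thesis by (intro power_mono) auto
  qed simp
  then show ?thesis by (simp add: power2_eq_square algebra_simps)
qed

lemma pmf_expectation_abs_le:
  fixes h :: "'a \<Rightarrow> real"
  assumes "finite (set_pmf \<kappa>)" "\<And>z. z \<in> set_pmf \<kappa> \<Longrightarrow> \<bar>h z\<bar> \<le> C"
  shows "\<bar>measure_pmf.expectation \<kappa> h\<bar> \<le> C"
proof -
  have int: "integrable (measure_pmf \<kappa>) g" for g :: "'a \<Rightarrow> real"
    using assms(1) by (rule integrable_measure_pmf_finite)
  have "\<bar>measure_pmf.expectation \<kappa> h\<bar> \<le> measure_pmf.expectation \<kappa> (\<lambda>z. \<bar>h z\<bar>)"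
    by (rule integral_abs_bound)
  also have "\<dots> \<le> measure_pmf.expectation \<kappa> (\<lambda>_. C)"
    using assms(2) by (intro integral_mono_AE int AE_pmfI) auto
  finally show ?thesis by simp
qed

text \<open>A near-minimiser \<open>\<kappa>\<close> of the sum of the squared positive parts of the expectations provides the
  multipliers: if that sum stayed positive, mixing in a point where the corresponding combination
  is nonpositive would decrease it.\<close>

lemma finite_moment_problem:
  fixes h :: "'i \<Rightarrow> 'a \<Rightarrow> real"
  assumes I: "finite I"
    and bound: "\<And>i z. i \<in> I \<Longrightarrow> z \<in> K \<Longrightarrow> \<bar>h i z\<bar> \<le> C"
    and comb: "\<And>c. (\<And>i. i \<in> I \<Longrightarrow> 0 \<le> c i) \<Longrightarrow> \<exists>z\<in>K. (\<Sum>i\<in>I. c i * h i z) \<le> 0"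
    and \<epsilon>: "\<epsilon> > 0"
  shows "\<exists>\<kappa>. finite (set_pmf \<kappa>) \<and> set_pmf \<kappa> \<subseteq> K \<and> (\<forall>i\<in>I. measure_pmf.expectation \<kappa> (h i) \<le> \<epsilon>)"
proof (rule ccontr)
  assume contra: "\<not> ?thesis"
  let ?E = "\<lambda>\<kappa> i. measure_pmf.expectation \<kappa> (h i)"
  define S where "S = {\<kappa>. finite (set_pmf \<kappa>) \<and> set_pmf \<kappa> \<subseteq> K}"
  define G where "G \<kappa> = (\<Sum>i\<in>I. (max 0 (?E \<kappa> i))\<^sup>2)" for \<kappa>
  have lower: "\<epsilon>\<^sup>2 \<le> G \<kappa>" if "\<kappa> \<in> S" for \<kappa>
  proof -
    obtain i where i: "i \<in> I" "\<epsilon> < ?E \<kappa> i" using contra \<open>\<kappa> \<in> S\<close> by (force simp: S_def)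
    have "\<epsilon>\<^sup>2 \<le> (max 0 (?E \<kappa> i))\<^sup>2" using i \<epsilon> by (intro power_mono) auto
    also have "\<dots> \<le> G \<kappa>" unfolding G_def using I i by (intro member_le_sum) auto
    finally show ?thesis .
  qed
  obtain z0 where z0: "z0 \<in> K" using comb[of "\<lambda>_. 0"] by auto
  then have Sne: "return_pmf z0 \<in> S" by (simp add: S_def)
  define G0 where "G0 = (INF \<kappa>\<in>S. G \<kappa>)"
  have G0_le: "G0 \<le> G \<kappa>" if "\<kappa> \<in> S" for \<kappa>
    unfolding G0_def using lower that by (intro cINF_lower bdd_belowI2) auto
  have "\<epsilon>\<^sup>2 \<le> G0" unfolding G0_def using lower Sne by (intro cINF_greatest) auto
  then have G0: "G0 > 0" using \<epsilon> by (smt (verit) zero_less_power)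
  \<comment> \<open>\<open>t\<^sup>2 * D\<close> bounds the total quadratic remainder;
    \<open>t\<close> is then chosen to keep it below \<open>t * G0\<close>.\<close>
  define D where "D = (2 * C)\<^sup>2 * card I"
  have D: "D \<ge> 0" by (simp add: D_def)
  define t where "t = min 1 (G0 / (D + 1))"
  have t: "t > 0" "t \<le> 1" "t * D \<le> G0"
  proof -
    show "t > 0" "t \<le> 1" using G0 D by (auto simp: t_def)
    have "t * D \<le> (G0 / (D + 1)) * (D + 1)" using G0 D by (intro mult_mono) (auto simp: t_def)
    then show "t * D \<le> G0" using D by simp
  qed
  \<comment> \<open>Mixing will lower \<open>G\<close> by at least \<open>t * G0\<close>, so a slack
    of half that amount suffices and no minimiser has to exist.\<close>
  have "\<exists>\<kappa>\<in>S. G \<kappa> < G0 + t * G0 / 2"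
  proof -
    have "G0 < G0 + t * G0 / 2" using t G0 by simp
    moreover have "bdd_below (G ` S)" using lower by (intro bdd_belowI2) auto
    ultimately show ?thesis using Sne unfolding G0_def by (subst (asm) cINF_less_iff) auto
  qed
  then obtain \<kappa> where \<kappa>: "\<kappa> \<in> S" "G \<kappa> < G0 + t * G0 / 2" by blast
  \<comment> \<open>The weights are, up to the factor 2, the partial derivatives of the penalty, so
    moving towards \<open>z\<close> is a descent direction.\<close>
  obtain z where z: "z \<in> K" "(\<Sum>i\<in>I. max 0 (?E \<kappa> i) * h i z) \<le> 0"
    using comb[of "\<lambda>i. max 0 (?E \<kappa> i)"] by auto
  define \<kappa>' where "\<kappa>' = bernoulli_pmf t \<bind> (\<lambda>b. if b then return_pmf z else \<kappa>)"
  have fin: "finite (set_pmf \<kappa>)" "set_pmf \<kappa> \<subseteq> K" using \<kappa>(1) by (auto simp: S_def)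
  have sub: "set_pmf \<kappa>' \<subseteq> insert z (set_pmf \<kappa>)"
    by (auto simp: \<kappa>'_def split: if_splits)
  then have "\<kappa>' \<in> S" using fin z(1) finite_subset[OF sub] by (auto simp: S_def)
  have E': "?E \<kappa>' i = ?E \<kappa> i + t * (h i z - ?E \<kappa> i)" for i
    unfolding \<kappa>'_def using fin t by (intro bernoulli_mixture_expectation) auto
  have "G \<kappa>' \<le> (\<Sum>i\<in>I. (max 0 (?E \<kappa> i))\<^sup>2 + 2 * t * (max 0 (?E \<kappa> i) * (h i z - ?E \<kappa> i)) + t\<^sup>2 * (2 * C)\<^sup>2)"
    unfolding G_def
  proof (rule sum_mono)
    fix i assume i: "i \<in> I"
    have "\<bar>h i z - ?E \<kappa> i\<bar> \<le> 2 * C"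
      using bound[OF i z(1)] pmf_expectation_abs_le[OF fin(1), of "h i" C] bound[OF i] fin(2) by force
    then have "(h i z - ?E \<kappa> i)\<^sup>2 \<le> (2 * C)\<^sup>2"
      using power_mono[of "\<bar>h i z - ?E \<kappa> i\<bar>" "2 * C" 2] by simp
    then have "t\<^sup>2 * (h i z - ?E \<kappa> i)\<^sup>2 \<le> t\<^sup>2 * (2 * C)\<^sup>2" by (intro mult_left_mono) auto
    then show "(max 0 (?E \<kappa>' i))\<^sup>2 \<le> (max 0 (?E \<kappa> i))\<^sup>2
        + 2 * t * (max 0 (?E \<kappa> i) * (h i z - ?E \<kappa> i)) + t\<^sup>2 * (2 * C)\<^sup>2"
      using pos_part_sq_add_le[of "?E \<kappa> i" t "h i z - ?E \<kappa> i"] unfolding E' by linarith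
  qed
  also have "\<dots> = G \<kappa> + 2 * t * ((\<Sum>i\<in>I. max 0 (?E \<kappa> i) * h i z) - G \<kappa>) + t\<^sup>2 * D"
  proof -
    have sq: "max 0 e * (u - e) = max 0 e * u - (max 0 e)\<^sup>2" for e u :: real
      by (cases "e \<le> 0") (auto simp: power2_eq_square algebra_simps)
    show ?thesis
      by (simp add: sq sum.distrib sum_subtractf sum_distrib_left[symmetric] G_def D_def)
  qed
  also have "\<dots> \<le> G \<kappa> - 2 * t * G \<kappa> + t * G0"
  proof -
    have "2 * t * ((\<Sum>i\<in>I. max 0 (?E \<kappa> i) * h i z) - G \<kappa>) \<le> 2 * t * (- G \<kappa>)"
      using z(2) t(1) by (intro mult_left_mono) auto
    moreover have "t\<^sup>2 * D \<le> t * G0"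
      using t by (simp add: power2_eq_square mult.assoc)
    ultimately show ?thesis by simp
  qed
  also have "\<dots> \<le> G \<kappa> - t * G0"
  proof -
    have "t * G0 \<le> t * G \<kappa>" using G0_le[OF \<kappa>(1)] t by simp
    then show ?thesis unfolding mult.assoc by linarith
  qed
  also have "\<dots> < G0" using \<kappa>(2) t(1) G0 mult_pos_pos[OF t(1) G0] by linarith
  finally show False using G0_le[OF \<open>\<kappa>' \<in> S\<close>] by simp
qed

section \<open>A space-filling curve\<close>

text \<open>Schoenberg's curve: for \<open>t = (\<Sum>m. 2 * a m / 3 ^ Suc m)\<close> with digits \<open>a m \<in> {0, 1}\<close>, the
  number \<open>3 ^ m * t\<close> is, modulo 2, in \<open>[0, 1/3]\<close> or \<open>[2/3, 1]\<close> according to \<open>a m\<close>, so a clamped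
  cosine reads off the digit continuously.\<close>

definition schoenberg_digit :: "real \<Rightarrow> real" where
  "schoenberg_digit x = max 0 (min 1 (1 / 2 - cos (pi * x)))"

definition ternary :: "(nat \<Rightarrow> bool) \<Rightarrow> real" where
  "ternary a = (\<Sum>m. 2 * of_bool (a m) / 3 ^ Suc m)"

lemma ternary_summable: "summable (\<lambda>m. 2 * of_bool (a m) / 3 ^ Suc m :: real)"
proof (rule summable_comparison_test')
  show "summable (\<lambda>m. 2 / 3 * (1 / 3) ^ m :: real)" by (intro summable_mult summable_geometric) simp
  show "norm (2 * of_bool (a m) / 3 ^ Suc m :: real) \<le> 2 / 3 * (1 / 3) ^ m" for m
    by (simp add: power_divide)
qed

lemma ternary_nonneg: "0 \<le> ternary a"
  unfolding ternary_def by (intro suminf_nonneg ternary_summable) simp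

lemma ternary_le_1: "ternary a \<le> 1"
proof -
  have s: "(\<lambda>m. 2 / 3 * (1 / 3) ^ m :: real) sums (2 / 3 * (1 / (1 - 1 / 3)))"
    by (intro sums_mult geometric_sums) simp
  have "ternary a \<le> (\<Sum>m. 2 / 3 * (1 / 3) ^ m :: real)"
    unfolding ternary_def
    by (rule suminf_le[OF _ ternary_summable sums_summable[OF s]]) (simp add: power_divide)
  also have "\<dots> = 1" using sums_unique[OF s] by simp
  finally show ?thesis .
qed

text \<open>Multiplication by 3 shifts the digits and splits off an even integer, which the period 2
  of \<open>cos (pi * x)\<close> ignores. Iteration reaches the digit at any position.\<close>

lemma ternary_step: "3 * ternary a = 2 * of_bool (a 0) + ternary (\<lambda>m. a (Suc m))"
proof -
  have "ternary a = 2 * of_bool (a 0) / 3 + (\<Sum>m. 2 * of_bool (a (Suc m)) / 3 ^ Suc (Suc m))"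
    unfolding ternary_def by (subst suminf_split_head[OF ternary_summable]) simp
  also have "(\<Sum>m. 2 * of_bool (a (Suc m)) / 3 ^ Suc (Suc m)) = ternary (\<lambda>m. a (Suc m)) / 3"
    unfolding ternary_def by (subst suminf_divide[OF ternary_summable, symmetric]) (simp add: field_simps)
  finally show ?thesis by simp
qed

text \<open>At 1/3 and 2/3 the function \<open>1 / 2 - cos (pi * x)\<close> equals 0 and 1; outside
  the middle third the clamp is saturated.\<close>

lemma schoenberg_digit_ternary_0: "schoenberg_digit (ternary a) = of_bool (a 0)"
proof -
  let ?s = "ternary (\<lambda>m. a (Suc m))"
  have s: "0 \<le> ?s" "?s \<le> 1" by (rule ternary_nonneg ternary_le_1)+
  have x: "ternary a = (2 * of_bool (a 0) + ?s) / 3" using ternary_step[of a] by simp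
  show ?thesis
  proof (cases "a 0")
    case True
    then have "cos (pi * ternary a) \<le> cos (2 * pi / 3)"
      using s by (intro cos_monotone_0_pi_le) (auto simp: x field_simps)
    also have "\<dots> = - 1 / 2" by (rule cos_120)
    finally show ?thesis using True by (simp add: schoenberg_digit_def min_def)
  next
    case False
    then have "cos (pi / 3) \<le> cos (pi * ternary a)"
      using s by (intro cos_monotone_0_pi_le) (auto simp: x field_simps)
    then show ?thesis using False by (simp add: schoenberg_digit_def cos_60)
  qed
qed

lemma schoenberg_digit_ternary: "schoenberg_digit (3 ^ m * ternary a) = of_bool (a m)"
proof -
  have "\<exists>j::int. 3 ^ m * ternary a = 2 * real_of_int j + ternary (\<lambda>k. a (m + k))"
  proof (induction m)
    case 0
    show ?case by (intro exI[of _ 0]) simp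
  next
    case (Suc m)
    then obtain j :: int where j: "3 ^ m * ternary a = 2 * real_of_int j + ternary (\<lambda>k. a (m + k))" by blast
    have "3 ^ Suc m * ternary a = 3 * (3 ^ m * ternary a)" by simp
    also have "\<dots> = 2 * (3 * real_of_int j) + 3 * ternary (\<lambda>k. a (m + k))" by (simp add: j)
    also have "\<dots> = 2 * (3 * real_of_int j + of_bool (a m)) + ternary (\<lambda>k. a (Suc m + k))"
      using ternary_step[of "\<lambda>k. a (m + k)"] by simp
    finally show ?case by (intro exI[of _ "3 * j + of_bool (a m)"]) simp
  qed
  then obtain j :: int where j: "3 ^ m * ternary a = 2 * real_of_int j + ternary (\<lambda>k. a (m + k))" by blast
  have "cos (pi * (3 ^ m * ternary a)) = cos (pi * ternary (\<lambda>k. a (m + k)) + 2 * pi * real_of_int j)"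
    unfolding j by (simp add: algebra_simps)
  also have "\<dots> = cos (pi * ternary (\<lambda>k. a (m + k)))"
    by (simp add: cos_add cos_int_2pin sin_int_2pin)
  finally have "schoenberg_digit (3 ^ m * ternary a) = schoenberg_digit (ternary (\<lambda>k. a (m + k)))"
    by (simp add: schoenberg_digit_def)
  then show ?thesis using schoenberg_digit_ternary_0[of "\<lambda>k. a (m + k)"] by simp
qed

text \<open>Greedy digits, where \<open>r n\<close> is the remainder rescaled to
  \<open>[0, 1]\<close>. The endpoint 1 is a fixed point of the recursion and receives only
  ones.\<close>

lemma binary_expansion:
  fixes y :: real
  assumes "0 \<le> y" "y \<le> 1"
  obtains b :: "nat \<Rightarrow> bool" where "(\<lambda>k. of_bool (b k) * (1 / 2) ^ Suc k) sums y"
proof -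
  define r where "r = rec_nat y (\<lambda>_ s. 2 * s - of_bool (s \<ge> 1 / 2))"
  have r0: "r 0 = y" and rS: "r (Suc n) = 2 * r n - of_bool (r n \<ge> 1 / 2)" for n
    by (auto simp: r_def)
  have r: "0 \<le> r n \<and> r n \<le> 1" for n
    by (induction n) (use assms in \<open>auto simp: r0 rS\<close>)
  have part: "(\<Sum>k<n. of_bool (r k \<ge> 1 / 2) * (1 / 2) ^ Suc k) = y - r n * (1 / 2) ^ n" for n
    by (induction n) (auto simp: r0 rS algebra_simps)
  have "(\<lambda>n. y - r n * (1 / 2) ^ n) \<longlonglongrightarrow> y - 0"
  proof (intro tendsto_diff tendsto_const Lim_null_comparison[of "\<lambda>n. r n * (1 / 2) ^ n"])
    show "\<forall>\<^sub>F n in sequentially. norm (r n * (1 / 2) ^ n) \<le> (1 / 2) ^ n"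
      using r by (auto intro!: always_eventually simp: abs_mult mult_left_le_one_le)
    show "(\<lambda>n. (1 / 2) ^ n :: real) \<longlonglongrightarrow> 0" by (rule LIMSEQ_power_zero) simp
  qed
  then have "(\<lambda>k. of_bool (r k \<ge> 1 / 2) * (1 / 2) ^ Suc k) sums y"
    unfolding sums_def part by simp
  then show thesis by (rule that)
qed

text \<open>One digit sequence encodes all coordinates, the positions \<open>d * k + e i\<close>
  belonging to coordinate \<open>i\<close>. The digit reader is defined and continuous for every
  real, so the binary series converges uniformly; surjectivity is needed only from points of the
  Cantor set.\<close>

lemma space_filling_curve:
  obtains \<sigma> :: "'i::finite \<Rightarrow> real \<Rightarrow> real"
  where "\<And>i. continuous_on UNIV (\<sigma> i)" "\<And>i t. 0 \<le> \<sigma> i t" "\<And>i t. \<sigma> i t \<le> 1"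
    "\<And>y. (\<And>i. 0 \<le> y i) \<Longrightarrow> (\<And>i. y i \<le> 1) \<Longrightarrow> \<exists>t\<in>{0..1}. \<forall>i. \<sigma> i t = y i"
proof -
  define d where "d = CARD('i)"
  obtain e :: "'i \<Rightarrow> nat" where e: "bij_betw e UNIV {0..<d}"
    using ex_bij_betw_finite_nat[of "UNIV :: 'i set"] by (auto simp: d_def)
  have ed: "e i < d" for i using e by (auto simp: bij_betw_def)
  define \<sigma> where "\<sigma> i t = (\<Sum>k. schoenberg_digit (3 ^ (d * k + e i) * t) * (1 / 2) ^ Suc k)" for i t
  have half: "(\<lambda>k. (1 / 2) ^ Suc k :: real) sums 1" by (rule power_half_series)
  have dig: "0 \<le> schoenberg_digit x" "schoenberg_digit x \<le> 1" for x
    by (auto simp: schoenberg_digit_def)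
  have le: "schoenberg_digit x * (1 / 2) ^ Suc k \<le> (1 / 2) ^ Suc k" for x k
    using dig by (intro mult_left_le_one_le) auto
  have summ: "summable (\<lambda>k. schoenberg_digit (u k) * (1 / 2) ^ Suc k)" for u
    by (rule summable_comparison_test'[OF sums_summable[OF half]])
       (use le dig in \<open>simp add: abs_mult\<close>)
  show thesis
  proof (rule that)
    fix i
    have "uniform_limit UNIV (\<lambda>n t. \<Sum>k<n. schoenberg_digit (3 ^ (d * k + e i) * t) * (1 / 2) ^ Suc k) (\<sigma> i) sequentially"
      unfolding \<sigma>_def[abs_def]
      by (rule Weierstrass_m_test[OF _ sums_summable[OF half]])
         (use le dig in \<open>simp add: abs_mult\<close>)
    then show "continuous_on UNIV (\<sigma> i)"
      by (rule uniform_limit_theorem[rotated])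
         (auto intro!: always_eventually continuous_intros simp: schoenberg_digit_def)
    fix t
    show "0 \<le> \<sigma> i t" unfolding \<sigma>_def by (intro suminf_nonneg summ) (simp add: dig)
    have "\<sigma> i t \<le> (\<Sum>k. (1 / 2) ^ Suc k)"
      unfolding \<sigma>_def by (rule suminf_le[OF le summ sums_summable[OF half]])
    then show "\<sigma> i t \<le> 1" using sums_unique[OF half] by simp
  next
    fix y :: "'i \<Rightarrow> real" assume y: "\<And>i. 0 \<le> y i" "\<And>i. y i \<le> 1"
    have "\<exists>b :: nat \<Rightarrow> bool. (\<lambda>k. of_bool (b k) * (1 / 2) ^ Suc k) sums y i" for i
      using binary_expansion[OF y] by metis
    then obtain b :: "'i \<Rightarrow> nat \<Rightarrow> bool" where b: "\<And>i. (\<lambda>k. of_bool (b i k) * (1 / 2) ^ Suc k) sums y i"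
      by metis
    \<comment> \<open>Interleaving: position \<open>m\<close> carries digit \<open>m div d\<close>
      of the coordinate numbered \<open>m mod d\<close>.\<close>
    define a where "a m = b (inv e (m mod d)) (m div d)" for m
    have "inj e" using e by (simp add: bij_betw_def)
    then have a: "a (d * k + e i) = b i k" for k i
      using ed[of i] by (simp add: a_def)
    have "\<sigma> i (ternary a) = y i" for i
      unfolding \<sigma>_def schoenberg_digit_ternary a using sums_unique[OF b] by simp
    then show "\<exists>t\<in>{0..1}. \<forall>i. \<sigma> i t = y i"
      using ternary_nonneg ternary_le_1 by (intro bexI[of _ "ternary a"]) auto
  qed
qed

section \<open>Separability of spaces of continuous functions\<close>

text \<open>Record the modulus of continuity of \<open>G s\<close> and its rounded values on a
  finite net. There are countably many such records, and one index is chosen for each record that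
  occurs, which places \<open>T\<close> inside \<open>S\<close>.\<close>

lemma countable_uniformly_dense_subset:
  fixes G :: "'s \<Rightarrow> 'a::metric_space \<Rightarrow> 'b::{metric_space,second_countable_topology}"
  assumes K: "compact K" and cont: "\<And>s. s \<in> S \<Longrightarrow> continuous_on K (G s)"
  obtains T where "countable T" "T \<subseteq> S"
    "\<And>s e. s \<in> S \<Longrightarrow> 0 < e \<Longrightarrow> \<exists>s'\<in>T. \<forall>x\<in>K. dist (G s x) (G s' x) < e"
proof -
  obtain D :: "'b set" where D: "countable D" "\<And>X. open X \<Longrightarrow> X \<noteq> {} \<Longrightarrow> \<exists>d\<in>D. d \<in> X"
    using countable_dense_exists by blast
  have "\<exists>A. finite A \<and> A \<subseteq> K \<and> K \<subseteq> (\<Union>a\<in>A. ball a (inverse (Suc m)))" for m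
  proof -
    have "K \<subseteq> (\<Union>a\<in>K. ball a (inverse (Suc m)))" by force
    from compactE_image[OF K _ this] show ?thesis by (metis open_ball)
  qed
  then obtain A where A: "\<And>m. finite (A m)" "\<And>m. A m \<subseteq> K"
      "\<And>m. K \<subseteq> (\<Union>a\<in>A m. ball a (inverse (Suc m)))"
    by metis
  \<comment> \<open>\<open>R m j c s\<close>: the scale \<open>m\<close> controls oscillation up to
    \<open>inverse (Suc j)\<close>, and \<open>c\<close> lists the values on the net with that
    accuracy.\<close>
  define R where "R m j c s \<longleftrightarrow> s \<in> S \<and> (\<forall>x\<in>K. \<forall>y\<in>K. dist x y < inverse (Suc m) \<longrightarrow> dist (G s x) (G s y) < inverse (Suc j))
      \<and> (\<forall>a\<in>A m. dist (G s a) (c a) < inverse (Suc j))" for m j c s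
  define T where "T = (\<Union>m. \<Union>j. (\<lambda>c. SOME s. R m j c s) ` {c \<in> Pi\<^sub>E (A m) (\<lambda>_. D). \<exists>s. R m j c s})"
  show thesis
  proof (rule that)
    have "countable (Pi\<^sub>E (A m) (\<lambda>_. D))" for m using A(1) D(1) by (intro countable_PiE) auto
    then show "countable T" unfolding T_def by (auto intro!: countable_image intro: countable_subset[rotated])
    have "(SOME s. R m j c s) \<in> S" if "\<exists>s. R m j c s" for m j c
      using someI_ex[OF that] by (simp add: R_def)
    then show "T \<subseteq> S" by (auto simp: T_def)
    fix s and e :: real assume s: "s \<in> S" and e: "0 < e"
    \<comment> \<open>Four errors add up: two from moving between \<open>x\<close> and the net
      point, two from rounding to \<open>c a\<close>.\<close>
    obtain j where j: "inverse (Suc j) < e / 4" using reals_Archimedean[of "e / 4"] e by auto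
    have "uniformly_continuous_on K (G s)" by (rule compact_uniformly_continuous[OF cont[OF s] K])
    then obtain \<delta> where \<delta>: "\<delta> > 0" "\<And>x y. x \<in> K \<Longrightarrow> y \<in> K \<Longrightarrow> dist x y < \<delta> \<Longrightarrow> dist (G s x) (G s y) < inverse (Suc j)"
      unfolding uniformly_continuous_on_def by (metis inverse_positive_iff_positive of_nat_0_less_iff zero_less_Suc)
    obtain m where m: "inverse (Suc m) < \<delta>" using reals_Archimedean[OF \<delta>(1)] by auto
    have "\<exists>d\<in>D. d \<in> ball (G s a) (inverse (Suc j))" for a by (rule D(2)) auto
    then obtain c where c: "\<And>a. c a \<in> D" "\<And>a. dist (G s a) (c a) < inverse (Suc j)"
      by (metis mem_ball)
    have Rs: "R m j (restrict c (A m)) s" using s \<delta>(2) m c by (auto simp: R_def)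
    define s' where "s' = (SOME s. R m j (restrict c (A m)) s)"
    have Rs': "R m j (restrict c (A m)) s'" unfolding s'_def by (rule someI[of _ s]) (rule Rs)
    have "restrict c (A m) \<in> {c \<in> Pi\<^sub>E (A m) (\<lambda>_. D). \<exists>s. R m j c s}" using Rs c(1) by auto
    then have "s' \<in> (\<lambda>c. SOME s. R m j c s) ` {c \<in> Pi\<^sub>E (A m) (\<lambda>_. D). \<exists>s. R m j c s}"
      unfolding s'_def by (rule imageI)
    then have "s' \<in> T" unfolding T_def by blast
    moreover have "dist (G s x) (G s' x) < e" if x: "x \<in> K" for x
    proof -
      obtain a where a: "a \<in> A m" "dist a x < inverse (Suc m)" using A(3)[of m] x by auto
      then have aK: "a \<in> K" using A(2) by blast
      have "dist (G s a) (G s x) < inverse (Suc j)" "dist (G s' a) (G s' x) < inverse (Suc j)"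
        using Rs Rs' aK x a(2) unfolding R_def by blast+
      moreover have "dist (G s a) (c a) < inverse (Suc j)" "dist (G s' a) (c a) < inverse (Suc j)"
        using Rs Rs' a(1) unfolding R_def by (metis restrict_apply')+
      ultimately show ?thesis
        using dist_triangle[of "G s x" "G s' x" "G s a"] dist_triangle2[of "G s a" "G s' a" "c a"]
          dist_triangle[of "G s a" "G s' x" "G s' a"] j
        by (simp add: dist_commute)
    qed
    ultimately show "\<exists>s'\<in>T. \<forall>x\<in>K. dist (G s x) (G s' x) < e" by blast
  qed
qed


section \<open>Existence of the Mather measure\<close>

text \<open>The momentum coordinates fill the box with entries in \<open>[-P, P]\<close>, which
  contains the ball of radius \<open>P\<close>. Finite measures on this part of phase space thus
  lift to the interval \<open>[0, 1]\<close>, and \<open>X\<close> keeps continuous functions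
  bounded along the whole curve.\<close>

lemma phase_space_curve:
  assumes P: "P > 0"
  obtains g :: "real \<Rightarrow> (real^'n) \<times> (real^'n)" and X
  where "continuous_on UNIV g" "compact X" "range g \<subseteq> X" "\<And>t. fst (g t) \<in> unit_cube"
    "\<And>x p. x \<in> unit_cube \<Longrightarrow> norm p \<le> P \<Longrightarrow> \<exists>t\<in>{0..1}. g t = (x, p)"
proof -
  obtain \<sigma> :: "'n + 'n \<Rightarrow> real \<Rightarrow> real" where \<sigma>: "\<And>i. continuous_on UNIV (\<sigma> i)"
    "\<And>i t. 0 \<le> \<sigma> i t" "\<And>i t. \<sigma> i t \<le> 1"
    "\<And>y. (\<And>i. 0 \<le> y i) \<Longrightarrow> (\<And>i. y i \<le> 1) \<Longrightarrow> \<exists>t\<in>{0..1}. \<forall>i. \<sigma> i t = y i"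
    using space_filling_curve by blast
  define g :: "real \<Rightarrow> (real^'n) \<times> (real^'n)"
    where "g t = ((\<chi> i. \<sigma> (Inl i) t), (\<chi> i. P * (2 * \<sigma> (Inr i) t - 1)))" for t
  show thesis
  proof (rule that)
    show "continuous_on UNIV g"
      unfolding g_def by (intro continuous_on_Pair continuous_on_vec_lambda continuous_intros \<sigma>(1))
    show "compact (unit_cube \<times> cbox (\<chi> i. - P) (\<chi> i. P) :: ((real^'n) \<times> (real^'n)) set)"
      by (intro compact_Times compact_unit_cube compact_cbox)
    have "- P \<le> P * (2 * s - 1)" "P * (2 * s - 1) \<le> P" if "0 \<le> s" "s \<le> 1" for s
    proof -
      have "P * (- 1) \<le> P * (2 * s - 1)" "P * (2 * s - 1) \<le> P * 1"
        using that P by (intro mult_left_mono; simp)+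
      then show "- P \<le> P * (2 * s - 1)" "P * (2 * s - 1) \<le> P" by simp_all
    qed
    then show "range g \<subseteq> unit_cube \<times> cbox (\<chi> i. - P) (\<chi> i. P)"
      using \<sigma>(2,3) by (auto simp: g_def unit_cube_def mem_box_cart)
    show "fst (g t) \<in> unit_cube" for t
      using \<sigma>(2,3) by (auto simp: g_def unit_cube_def mem_box_cart)
    fix x p :: "real^'n" assume x: "x \<in> unit_cube" and p: "norm p \<le> P"
    let ?y = "case_sum (\<lambda>i. x $ i) (\<lambda>i. (p $ i / P + 1) / 2)"
    have "0 \<le> P + p $ i \<and> p $ i \<le> P" for i
      using component_le_norm_cart[of p i] p by linarith
    then have "0 \<le> ?y i" "?y i \<le> 1" for i
      using x P by (auto simp: unit_cube_def mem_box_cart field_simps split: sum.split)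
    from \<sigma>(4)[of ?y, OF this] obtain t where t: "t \<in> {0..1}" "\<And>i. \<sigma> i t = ?y i" by blast
    have "g t = (x, p)" using t(2) P by (simp add: g_def vec_eq_iff field_simps)
    then show "\<exists>t\<in>{0..1}. g t = (x, p)" using t(1) by blast
  qed
qed

lemma grad_zero_at_maximum:
  fixes f :: "real^'n \<Rightarrow> real"
  assumes "C1_fun f" "\<And>y. f y \<le> f x"
  shows "grad f x = 0"
proof -
  have "(\<lambda>h. grad f x \<bullet> h) = (\<lambda>h. 0)"
    by (rule differential_zero_maxmin[of x UNIV f]) (use assms C1_funE in auto)
  then have "grad f x \<bullet> grad f x = 0" by metis
  then show ?thesis by simp
qed

text \<open>The supremum runs over uncountably many momenta, but each member is continuous in
  \<open>(x, v)\<close>; superlevel sets are unions of open sets.\<close>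

lemma lagrangian_borel_measurable:
  fixes H :: "real^'n \<Rightarrow> real^'n \<Rightarrow> real"
  assumes H: "hamiltonian_ok H"
  shows "(\<lambda>(x, v). lagrangian H x v) \<in> borel_measurable borel"
proof (rule borel_measurableI_greater)
  fix y :: real
  let ?U = "\<lambda>p. {z :: (real^'n) \<times> (real^'n). y < p \<bullet> snd z - H (fst z) p}"
  have "y < lagrangian H x v \<longleftrightarrow> (\<exists>p. y < p \<bullet> v - H x p)" for x v
  proof
    assume L: "y < lagrangian H x v"
    show "\<exists>p. y < p \<bullet> v - H x p"
    proof (rule ccontr)
      assume "\<nexists>p. y < p \<bullet> v - H x p"
      then have "lagrangian H x v \<le> y" unfolding lagrangian_def by (intro cSUP_least) (auto simp: not_less)
      then show False using L by simp
    qed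
  next
    assume "\<exists>p. y < p \<bullet> v - H x p"
    then show "y < lagrangian H x v" using lagrangian_ge[OF H] by (metis less_le_trans)
  qed
  then have "{z \<in> space borel. y < (case z of (x, v) \<Rightarrow> lagrangian H x v)} = (\<Union>p. ?U p)"
    by (auto simp: split_beta)
  moreover have "open (?U p)" for p
    by (intro open_Collect_less continuous_intros
        continuous_on_compose2[OF hamiltonian_continuous[OF H], of UNIV "\<lambda>z. (fst z, p)", simplified])
  ultimately show "{z \<in> space borel. y < (case z of (x, v) \<Rightarrow> lagrangian H x v)} \<in> sets borel"
    by (auto intro!: borel_open)
qed

lemma unit_cell_borel: "(unit_cell :: (real^'n) set) \<in> sets borel"
proof -
  have "(unit_cell :: (real^'n) set) = (\<Inter>i. {x. 0 \<le> x $ i} \<inter> {x. x $ i < 1})"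
    by (auto simp: unit_cell_def)
  moreover
  have "{x :: real^'n. 0 \<le> x $ i} \<inter> {x. x $ i < 1} \<in> sets borel" for i
    by (intro sets.Int borel_closed borel_open closed_Collect_le open_Collect_less continuous_intros)
  then have "(\<Inter>i. {x :: real^'n. 0 \<le> x $ i} \<inter> {x. x $ i < 1}) \<in> sets borel"
    by (intro sets.finite_INT) auto
  ultimately show ?thesis by simp
qed

text \<open>All mass lies in one bounded interval, so the sequence is tight and a subsequence
  converges weakly to a probability measure.\<close>

lemma helly_finite_pmfs:
  fixes \<kappa> :: "nat \<Rightarrow> real pmf"
  assumes "\<And>n. set_pmf (\<kappa> n) \<subseteq> {0..1}"
  obtains r M where "strict_mono (r :: nat \<Rightarrow> nat)" "prob_space M" "sets M = sets borel"
    "\<And>f :: real \<Rightarrow> real. \<And>B. continuous_on UNIV f \<Longrightarrow> (\<And>x. \<bar>f x\<bar> \<le> B) \<Longrightarrow>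
       (\<lambda>n. measure_pmf.expectation (\<kappa> (r n)) f) \<longlonglongrightarrow> integral\<^sup>L M f"
proof -
  define \<mu> where "\<mu> n = distr (measure_pmf (\<kappa> n)) borel (\<lambda>x. x)" for n
  have rd: "real_distribution (\<mu> n)" for n
    unfolding \<mu>_def by (rule prob_space.real_distribution_distr[OF prob_space_measure_pmf]) simp
  \<comment> \<open>Tightness is expressed with left-open intervals; starting at -1 keeps the
    possible atom at 0.\<close>
  have "measure (\<mu> n) {-1<..1} = 1" for n
  proof -
    have "measure (\<mu> n) {-1<..1} = measure_pmf.prob (\<kappa> n) {-1<..1}"
      unfolding \<mu>_def by (subst measure_distr) auto
    also have "\<dots> = 1" using assms[of n]
      by (subst measure_pmf.prob_eq_1) (auto simp: AE_measure_pmf_iff)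
    finally show ?thesis .
  qed
  then have "\<exists>a b. a < b \<and> (\<forall>n. measure (\<mu> n) {a<..b} > 1 - \<epsilon>)" if "\<epsilon> > 0" for \<epsilon>
    using that by (intro exI[of _ "- 1 :: real"] exI[of _ "1 :: real"]) simp
  then have "tight \<mu>" unfolding tight_def using rd by blast
  from tight_imp_convergent_subsubsequence[OF this strict_mono_id]
  obtain r M where rM: "strict_mono r" "real_distribution M" "weak_conv_m (\<mu> \<circ> id \<circ> r) M" by blast
  show thesis
  proof (rule that)
    show "strict_mono r" by fact
    show "prob_space M" "sets M = sets borel"
      using rM(2) by (auto simp: real_distribution_def real_distribution_axioms_def)
    fix f :: "real \<Rightarrow> real" and B assume f: "continuous_on UNIV f" "\<And>x. \<bar>f x\<bar> \<le> B"
    have "(\<lambda>n. integral\<^sup>L ((\<mu> \<circ> id \<circ> r) n) f) \<longlonglongrightarrow> integral\<^sup>L M f"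
      by (rule weak_conv_imp_integral_bdd_continuous_conv[OF _ rM(2,3), where B = B])
         (use f rd in \<open>auto simp: continuous_on_eq_continuous_at\<close>)
    moreover have "integral\<^sup>L (\<mu> n) f = measure_pmf.expectation (\<kappa> n) f" for n
      unfolding \<mu>_def using f by (subst integral_distr) (auto intro: borel_measurable_continuous_onI)
    ultimately show "(\<lambda>n. measure_pmf.expectation (\<kappa> (r n)) f) \<longlonglongrightarrow> integral\<^sup>L M f" by simp
  qed
qed

text \<open>Parametrising velocities by momenta, \<open>v = grad (H x) p\<close>, makes the action
  \<open>p \<bullet> v - H x p\<close> continuous, and confines the measures to the compact set \<open>norm p \<le> P\<close>.\<close>

lemma mather_measure_concentrated_on_minimum:
  fixes H :: "real^'n \<Rightarrow> real^'n \<Rightarrow> real"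
  assumes H: "hamiltonian_ok H" and w1: "visc_sol H 0 w1" and w2: "visc_sol H 0 w2"
    and m: "\<And>x. m \<le> w2 x - w1 x" "w2 x0 - w1 x0 = m"
  shows "\<exists>\<mu>\<in>mather_measures H. (\<integral>(x, v). w2 x - w1 x - m \<partial>\<mu>) = 0"
proof -

  \<comment> \<open>Data and momentum cutoff\<close>
  define f where "f x = w2 x - w1 x - m" for x
  define V where "V z = grad (H (fst z)) (snd z)" for z
  define l where "l z = snd z \<bullet> V z - H (fst z) (snd z)" for z
  have w': "continuous_on UNIV w1" "periodic_fun w1" "continuous_on UNIV w2" "periodic_fun w2"
    using w1 w2 by (auto simp: visc_sol_def)
  have fc: "continuous_on UNIV f" unfolding f_def by (intro continuous_intros w')
  have fp: "periodic_fun f" using w' by (simp add: periodic_fun_def f_def)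
  have f0: "f x \<ge> 0" for x using m(1)[of x] by (simp add: f_def)
  have Vc: "continuous_on UNIV V" unfolding V_def by (rule hamiltonian_grad_continuous[OF H])
  have lc: "continuous_on UNIV l"
    unfolding l_def by (intro continuous_intros Vc hamiltonian_continuous[OF H])
  have fstc: "continuous_on UNIV (\<lambda>z. F (fst z))" if "continuous_on UNIV F"
    for F :: "real^'n \<Rightarrow> 'b::topological_space"
    by (rule continuous_on_compose2[OF that]) (auto intro: continuous_intros)
  obtain F where F: "F > 0" "\<And>x. \<bar>f x\<bar> \<le> F" using periodic_bounded[OF fc fp] by metis
  have "continuous_on UNIV (\<lambda>x. H x 0)"
    using continuous_on_compose2[OF hamiltonian_continuous[OF H],
        OF continuous_on_Pair[OF continuous_on_id continuous_on_const]] by simp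
  moreover have "periodic_fun (\<lambda>x. H x 0)"
    using hamiltonian_periodic[OF H] by (simp add: periodic_fun_def)
  ultimately obtain B0 where B0: "B0 > 0" "\<And>x. \<bar>H x 0\<bar> \<le> B0" using periodic_bounded by metis
  \<comment> \<open>Beyond \<open>P\<close> the Hamiltonian exceeds both \<open>f x\<close> and
    \<open>H x 0\<close>, which lets larger momenta be replaced by momenta of norm
    \<open>P\<close>.\<close>
  obtain P where P: "P > 0" "\<And>x p. norm p \<ge> P \<Longrightarrow> H x p \<ge> F + B0 + 1"
    using hamiltonian_coercive[OF H] by metis
  obtain g :: "real \<Rightarrow> (real^'n) \<times> (real^'n)" and X where
    g: "continuous_on UNIV g" "compact X" "range g \<subseteq> X" "\<And>t. fst (g t) \<in> unit_cube"
    "\<And>x p. x \<in> unit_cube \<Longrightarrow> norm p \<le> P \<Longrightarrow> \<exists>t\<in>{0..1}. g t = (x, p)"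
    using phase_space_curve[OF P(1)] by metis
  have cg: "continuous_on UNIV (\<lambda>t. G (g t))" if "continuous_on UNIV G"
    for G :: "_ \<Rightarrow> 'b::topological_space"
    by (rule continuous_on_compose2[OF that g(1)]) auto
  have bg: "\<exists>B. \<forall>t. norm (G (g t)) \<le> B" if G: "continuous_on UNIV G" for G :: "_ \<Rightarrow> 'b::real_normed_vector"
  proof -
    have "compact (G ` X)"
      by (intro compact_continuous_image g continuous_on_subset[OF G]) auto
    then obtain B where "\<forall>y\<in>G ` X. norm y \<le> B"
      using compact_imp_bounded bounded_iff by metis
    then show ?thesis using g(3) by blast
  qed

  \<comment> \<open>The countable system of constraints\<close>
  define S where "S = {\<phi> :: real^'n \<Rightarrow> real. C1_fun \<phi> \<and> periodic_fun \<phi>}"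
  obtain T where T: "countable T" "T \<subseteq> S"
    "\<And>s e. s \<in> S \<Longrightarrow> 0 < e \<Longrightarrow> \<exists>s'\<in>T. \<forall>x\<in>unit_cube. dist (grad s x) (grad s' x) < e"
    using countable_uniformly_dense_subset[OF compact_unit_cube, of S grad]
      C1_funE(1) unfolding S_def by (metis (mono_tags, lifting) continuous_on_subset mem_Collect_eq subset_UNIV)
  have "(\<lambda>_. 0) \<in> S"
    using C1_funI(1)[of "\<lambda>_. 0" "\<lambda>_. 0"] by (simp add: S_def periodic_fun_def)
  then have Tne: "T \<noteq> {}" using T(3)[of _ 1] by force
  define \<phi> where "\<phi> = from_nat_into T"
  have \<phi>S: "C1_fun (\<phi> k)" "periodic_fun (\<phi> k)" for k
    using from_nat_into[OF Tne, of k] T(2) by (auto simp: \<phi>_def S_def)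
  \<comment> \<open>Index 0 asks for action plus \<open>f\<close> to be nonpositive in mean, the
    others for half of holonomy; the opposite half comes at the end from the symmetry of
    \<open>S\<close> under negation.\<close>
  define h where "h i z = (case i of 0 \<Rightarrow> l z + f (fst z) | Suc k \<Rightarrow> - (V z \<bullet> grad (\<phi> k) (fst z)))" for i z
  have hc: "continuous_on UNIV (h i)" for i
    unfolding h_def by (cases i) (auto intro!: continuous_intros lc Vc fstc fc C1_funE(1) \<phi>S)
  obtain C where C: "\<And>i t. \<bar>h i (g t)\<bar> \<le> C i" using bg[OF hc] by (metis real_norm_def)

  \<comment> \<open>Nonnegative combinations of the constraints\<close>
  have comb: "\<exists>t\<in>{0..1}. (\<Sum>i\<le>N. c i * h i (g t)) \<le> 0" if c: "\<And>i. i \<in> {..N} \<Longrightarrow> 0 \<le> c i" for N c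
  proof -
    have "\<exists>x\<in>unit_cube. \<exists>p. norm p \<le> P \<and> (\<Sum>i\<le>N. c i * h i (x, p)) \<le> 0"
    proof -
      define \<Psi> where "\<Psi> x = (\<Sum>k<N. c (Suc k) * \<phi> k x)" for x
      have \<Psi>: "C1_fun \<Psi>" "grad \<Psi> = (\<lambda>x. \<Sum>k<N. c (Suc k) *\<^sub>R grad (\<phi> k) x)"
        unfolding \<Psi>_def[abs_def] by (rule C1_fun_sum; rule \<phi>S)+
      have \<Psi>p: "periodic_fun \<Psi>" using \<phi>S(2) by (simp add: \<Psi>_def periodic_fun_def)
      have sum_eq: "(\<Sum>i\<le>N. c i * h i z) = c 0 * (l z + f (fst z)) - V z \<bullet> grad \<Psi> (fst z)" for z
        by (simp add: sum.atMost_shift h_def \<Psi>(2) inner_sum_right sum_negf)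
      show ?thesis
      \<comment> \<open>Without weight on the action there is nothing to normalise by; a critical
        point of \<open>\<Psi>\<close> makes the combination zero.\<close>
      proof (cases "c 0 = 0")
        case True
        have "\<exists>x. \<forall>y. \<Psi> y \<le> \<Psi> x" by (rule periodic_attains_sup[OF C1_fun_continuous[OF \<Psi>(1)] \<Psi>p])
        then obtain x where "\<And>y. \<Psi> y \<le> \<Psi> x" by blast
        then have "grad \<Psi> x = 0" by (rule grad_zero_at_maximum[OF \<Psi>(1)])
        then have "grad \<Psi> (frac_vec x) = 0" by (simp add: periodic_frac[OF periodic_grad[OF \<Psi>(1) \<Psi>p]])
        then have "norm (0::real^'n) \<le> P \<and> (\<Sum>i\<le>N. c i * h i (frac_vec x, 0)) \<le> 0"
          unfolding sum_eq using True P(1) by simp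
        then show ?thesis using frac_vec_cube by blast
      next
        case False
        then have c0: "c 0 > 0" using c[of 0] by simp
        \<comment> \<open>The zero summand only fits the shape of
          \<open>C1_fun_lincomb\<close>.\<close>
        define \<psi> where "\<psi> x = inverse (c 0) * \<Psi> x + 0 * \<Psi> x" for x
        have \<psi>: "C1_fun \<psi>" "grad \<psi> = (\<lambda>x. inverse (c 0) *\<^sub>R grad \<Psi> x + 0 *\<^sub>R grad \<Psi> x)"
          unfolding \<psi>_def[abs_def] by (rule C1_fun_lincomb[OF \<Psi>(1) \<Psi>(1)])+
        have \<psi>p: "periodic_fun \<psi>" using \<Psi>p by (simp add: \<psi>_def periodic_fun_def)
        have g\<Psi>: "grad \<Psi> x = c 0 *\<^sub>R grad \<psi> x" for x using c0 by (simp add: \<psi>(2))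
        obtain x where "f x \<le> H x (grad \<psi> x)"
          using no_strict_subsolution[OF H w1 w2 m \<psi>(1) \<psi>p] by (auto simp: f_def)
        moreover obtain k where k: "int_vec k" "frac_vec x = x + k" using frac_vec_eq_add_int_vec by blast
        define x' where "x' = frac_vec x"
        ultimately have x': "f x' \<le> H x' (grad \<psi> x')" "x' \<in> unit_cube"
          using periodic_frac[OF fp, of x] periodic_frac[OF periodic_grad[OF \<psi>(1) \<psi>p], of x]
            hamiltonian_periodic[OF H k(1), of x] frac_vec_cube[of x]
          by (auto simp: x'_def k(2)[symmetric])
        define q where "q = grad \<psi> x'"
        have "\<exists>p. norm p \<le> P \<and> l (x', p) + f x' - V (x', p) \<bullet> q \<le> 0"
        \<comment> \<open>At \<open>p = q\<close> the expression is \<open>f x' - H x' q\<close>,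
          nonpositive by the choice of \<open>x'\<close>.\<close>
        proof (cases "norm q \<le> P")
          case True
          then show ?thesis using x'(1)
            by (intro exI[of _ q]) (simp add: l_def q_def V_def inner_commute)
        next
          case False
          \<comment> \<open>Radial projection to norm \<open>P\<close>. Since \<open>H x' p\<close>
            exceeds \<open>H x' 0\<close>, convexity gives
            \<open>V (x', p) \<bullet> p \<ge> 0\<close>, so enlarging \<open>p\<close> to
            \<open>q\<close> only lowers the expression, and \<open>f x' \<le> H x' p\<close>
            finishes.\<close>
          define p where "p = (P / norm q) *\<^sub>R q"
          have q0: "q \<noteq> 0" using False P(1) by (metis norm_zero less_imp_le)
          then have np: "norm p = P" using P(1) by (simp add: p_def)
          define b where "b = norm q / P"
          have b: "b > 1" and qp: "q = b *\<^sub>R p" using False P(1) q0 by (auto simp: b_def p_def)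
          have Hp: "H x' p \<ge> F + B0 + 1" using P(2) np by simp
          have "H x' p + V (x', p) \<bullet> (0 - p) \<le> H x' 0"
            using hamiltonian_tangent[OF H, of x' p 0] by (simp add: V_def)
          then have "V (x', p) \<bullet> p \<ge> 0" using Hp F(1) B0(2)[of x'] by (simp add: abs_le_iff)
          then have "0 \<le> (b - 1) * (V (x', p) \<bullet> p)" using b by simp
          then have "p \<bullet> V (x', p) \<le> V (x', p) \<bullet> q"
            by (simp add: qp inner_commute[of p] algebra_simps)
          moreover have "f x' \<le> H x' p" using Hp F(2)[of x'] B0(1) by linarith
          ultimately show ?thesis using np by (intro exI[of _ p]) (simp add: l_def)
        qed
        then obtain p where p: "norm p \<le> P" "l (x', p) + f x' - V (x', p) \<bullet> q \<le> 0" by blast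
        have "c 0 * (l (x', p) + f x' - V (x', p) \<bullet> q) \<le> 0"
          using p(2) c0 by (simp add: mult_le_0_iff)
        then have "(\<Sum>i\<le>N. c i * h i (x', p)) \<le> 0"
          unfolding sum_eq g\<Psi> by (simp add: q_def algebra_simps)
        then show ?thesis using x'(2) p(1) by blast
      qed
    qed
    then obtain x p where "x \<in> unit_cube" "norm p \<le> P" "(\<Sum>i\<le>N. c i * h i (x, p)) \<le> 0" by blast
    then show ?thesis using g(5) by metis
  qed

  \<comment> \<open>Approximate solutions and their weak limit\<close>
  have "\<exists>\<kappa>. finite (set_pmf \<kappa>) \<and> set_pmf \<kappa> \<subseteq> {0..1} \<and>
      (\<forall>i\<in>{..N}. measure_pmf.expectation \<kappa> (\<lambda>t. h i (g t)) \<le> inverse (Suc N))" for N :: nat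
  proof (rule finite_moment_problem[where C = "\<Sum>i\<le>N. C i"])
    fix i t assume i: "i \<in> {..N}"
    have "C j \<ge> 0" for j using C[of j 0] by linarith
    then have "C i \<le> (\<Sum>i\<le>N. C i)" using i by (intro member_le_sum) auto
    then show "\<bar>h i (g t)\<bar> \<le> (\<Sum>i\<le>N. C i)" using C[of i t] by linarith
  qed (use comb in auto)
  then obtain \<kappa> where \<kappa>: "\<And>N. set_pmf (\<kappa> N) \<subseteq> {0..1}"
    "\<And>N i. i \<le> N \<Longrightarrow> measure_pmf.expectation (\<kappa> N) (\<lambda>t. h i (g t)) \<le> inverse (Suc N)"
    by (metis atMost_iff)
  obtain r M where r: "strict_mono (r :: nat \<Rightarrow> nat)" and M: "prob_space M" "sets M = sets borel"
    and lim: "\<And>u :: real \<Rightarrow> real. \<And>B. continuous_on UNIV u \<Longrightarrow> (\<And>x. \<bar>u x\<bar> \<le> B) \<Longrightarrow>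
       (\<lambda>n. measure_pmf.expectation (\<kappa> (r n)) u) \<longlonglongrightarrow> integral\<^sup>L M u"
    using helly_finite_pmfs[of \<kappa>, OF \<kappa>(1)] by metis
  interpret M: prob_space M by (rule M)
  note [measurable_cong] = M(2)
  have hM: "integral\<^sup>L M (\<lambda>t. h i (g t)) \<le> 0" for i
  proof (rule LIMSEQ_le[OF lim[OF cg[OF hc]]])
    show "\<bar>h i (g t)\<bar> \<le> C i" for t by (rule C)
    show "(\<lambda>n. inverse (real (Suc n))) \<longlonglongrightarrow> 0" by (rule LIMSEQ_inverse_real_of_nat)
    have "measure_pmf.expectation (\<kappa> (r n)) (\<lambda>t. h i (g t)) \<le> inverse (real (Suc n))" if "n \<ge> i" for n
    proof -
      have "n \<le> r n" using r by (rule seq_suble)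
      then have "inverse (real (Suc (r n))) \<le> inverse (real (Suc n))" by (intro le_imp_inverse_le) auto
      then show ?thesis using \<kappa>(2)[of i "r n"] that \<open>n \<le> r n\<close> by linarith
    qed
    then show "\<exists>N. \<forall>n\<ge>N. measure_pmf.expectation (\<kappa> (r n)) (\<lambda>t. h i (g t)) \<le> inverse (real (Suc n))" by blast
  qed
  have int: "integrable M (\<lambda>t. G (g t))" if G: "continuous_on UNIV G" for G :: "_ \<Rightarrow> real"
  proof -
    obtain B where B: "\<And>t. norm (G (g t)) \<le> B" using bg[OF G] by blast
    have "(\<lambda>t. G (g t)) \<in> borel_measurable M"
      using borel_measurable_continuous_onI[OF cg[OF G]] by simp
    then show ?thesis using B by (intro M.integrable_const_bound[of _ B]) auto
  qed

  \<comment> \<open>Holonomy of the limit\<close>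
  have VDc: "continuous_on UNIV (\<lambda>z. V z \<bullet> grad \<psi> (fst z))" if "C1_fun \<psi>" for \<psi>
    by (intro continuous_intros Vc fstc C1_funE(1) that)
  have closed_ge: "0 \<le> (\<integral>t. V (g t) \<bullet> grad \<psi> (fst (g t)) \<partial>M)" if \<psi>: "\<psi> \<in> S" for \<psi>
  proof (rule field_le_epsilon)
    fix e :: real assume e: "e > 0"
    obtain B where B: "\<And>t. norm (V (g t)) \<le> B" using bg[OF Vc] by blast
    have B': "0 \<le> B" using B[of 0] norm_ge_zero order_trans by blast
    \<comment> \<open>Velocities along the curve are bounded by \<open>B\<close>, so gradients this
      close change the integral by at most \<open>e\<close>; the added 1 avoids division by
      zero.\<close>
    obtain s where s: "s \<in> T" "\<And>x. x \<in> unit_cube \<Longrightarrow> dist (grad \<psi> x) (grad s x) < e / (B + 1)"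
      using T(3)[OF \<psi>, of "e / (B + 1)"] e B' by auto
    obtain k where k: "s = \<phi> k" using s(1) T(1) unfolding \<phi>_def by (metis from_nat_into_surj)
    have C1: "C1_fun \<psi>" using \<psi> by (simp add: S_def)
    have "0 \<le> (\<integral>t. V (g t) \<bullet> grad (\<phi> k) (fst (g t)) \<partial>M)"
      using hM[of "Suc k"] by (simp add: h_def)
    also have "\<dots> \<le> (\<integral>t. V (g t) \<bullet> grad \<psi> (fst (g t)) + e \<partial>M)"
    proof (rule integral_mono)
      fix t
      let ?d = "grad (\<phi> k) (fst (g t)) - grad \<psi> (fst (g t))"
      have "V (g t) \<bullet> ?d \<le> norm (V (g t)) * norm ?d" by (rule norm_cauchy_schwarz)
      also have "\<dots> \<le> B * (e / (B + 1))"
        using s(2)[OF g(4), of t] B[of t] B' by (intro mult_mono) (auto simp: k dist_norm norm_minus_commute)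
      also have "\<dots> \<le> e" using e B' by (simp add: field_simps)
      finally show "V (g t) \<bullet> grad (\<phi> k) (fst (g t)) \<le> V (g t) \<bullet> grad \<psi> (fst (g t)) + e"
        by (simp add: inner_diff_right)
    qed (use int[OF VDc[OF \<phi>S(1)]] int[OF VDc[OF C1]] in auto)
    also have "\<dots> = (\<integral>t. V (g t) \<bullet> grad \<psi> (fst (g t)) \<partial>M) + e"
      using int[OF VDc[OF C1]] by (simp add: M.prob_space)
    finally show "0 \<le> (\<integral>t. V (g t) \<bullet> grad \<psi> (fst (g t)) \<partial>M) + e" .
  qed
  have closed_eq: "(\<integral>t. V (g t) \<bullet> grad \<psi> (fst (g t)) \<partial>M) = 0" if \<psi>: "C1_fun \<psi>" "periodic_fun \<psi>" for \<psi>
  proof (rule antisym)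
    note neg = C1_fun_lincomb[OF \<psi>(1) \<psi>(1), of "-1" 0]
    have "(\<lambda>x. - 1 * \<psi> x + 0 * \<psi> x) \<in> S" using neg(1) \<psi>(2) by (simp add: S_def periodic_fun_def)
    from closed_ge[OF this] show "(\<integral>t. V (g t) \<bullet> grad \<psi> (fst (g t)) \<partial>M) \<le> 0"
      unfolding neg(2) by simp
  qed (use closed_ge \<psi> in \<open>auto simp: S_def\<close>)

  \<comment> \<open>Transfer to the torus\<close>
  define \<Phi> where "\<Phi> t = (frac_vec (fst (g t)), V (g t))" for t
  have \<Phi>m [measurable]: "\<Phi> \<in> borel_measurable M"
  proof -
    have "(\<lambda>t. fst (g t)) \<in> borel_measurable M" "(\<lambda>t. V (g t)) \<in> borel_measurable M"
      using borel_measurable_continuous_onI[OF cg[OF fstc[OF continuous_on_id]]]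
        borel_measurable_continuous_onI[OF cg[OF Vc]] by simp_all
    then show ?thesis unfolding \<Phi>_def by measurable
  qed
  \<comment> \<open>The curve lives in the closed cube, while \<open>prob_TR\<close> demands the
    half-open cell. \<open>frac_vec\<close> moves the far faces over; it is Borel, and periodic
    integrands do not notice it.\<close>
  define \<mu> where "\<mu> = distr M borel \<Phi>"
  have prob: "prob_TR \<mu>"
    unfolding prob_TR_def
  proof (intro conjI)
    show "sets \<mu> = sets borel" by (simp add: \<mu>_def)
    show "prob_space \<mu>" unfolding \<mu>_def by (rule M.prob_space_distr) measurable
    have "(unit_cell \<times> UNIV :: ((real^'n) \<times> (real^'n)) set) \<in> sets borel"
      by (intro borel_Times unit_cell_borel) auto
    moreover have "\<Phi> -` (unit_cell \<times> UNIV) \<inter> space M = space M"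
      using frac_vec_cell by (auto simp: \<Phi>_def)
    ultimately show "emeasure \<mu> (unit_cell \<times> UNIV) = 1"
      by (simp add: \<mu>_def emeasure_distr M.emeasure_space_1)
  qed
  have cont2: "(\<lambda>(x, v). G x v) \<in> borel_measurable borel"
    if "continuous_on UNIV (\<lambda>z. G (fst z) (snd z))" for G :: "real^'n \<Rightarrow> real^'n \<Rightarrow> real"
    using borel_measurable_continuous_onI[OF that] by (simp add: split_beta)
  have hol: "\<mu> \<in> holonomic"
    unfolding holonomic_def
  proof (intro CollectI conjI prob allI impI)
    fix \<psi> :: "real^'n \<Rightarrow> real" assume "C1_fun \<psi> \<and> periodic_fun \<psi>"
    then have \<psi>: "C1_fun \<psi>" "periodic_fun \<psi>" by auto
    have meas: "(\<lambda>(x, v). v \<bullet> grad \<psi> x) \<in> borel_measurable borel"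
      by (intro cont2 continuous_intros fstc C1_funE(1) \<psi>)
    have eq: "(case \<Phi> t of (x, v) \<Rightarrow> v \<bullet> grad \<psi> x) = V (g t) \<bullet> grad \<psi> (fst (g t))" for t
      by (simp add: \<Phi>_def periodic_frac[OF periodic_grad[OF \<psi>]])
    show "integrable \<mu> (\<lambda>(x, v). v \<bullet> grad \<psi> x)"
      unfolding \<mu>_def by (subst integrable_distr_eq[OF \<Phi>m meas]) (simp add: eq int[OF VDc[OF \<psi>(1)]])
    show "(\<integral>(x, v). v \<bullet> grad \<psi> x \<partial>\<mu>) = 0"
      unfolding \<mu>_def by (subst integral_distr[OF \<Phi>m meas]) (simp add: eq closed_eq[OF \<psi>])
  qed

  \<comment> \<open>Action and concentration\<close>
  have Leq: "(case \<Phi> t of (x, v) \<Rightarrow> lagrangian H x v) = l (g t)" for t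
  proof -
    obtain k where k: "int_vec k" "frac_vec (fst (g t)) = fst (g t) + k" using frac_vec_eq_add_int_vec by blast
    then have "lagrangian H (frac_vec (fst (g t))) = lagrangian H (fst (g t))"
      using hamiltonian_periodic[OF H k(1)] by (simp add: lagrangian_def fun_eq_iff)
    then show ?thesis by (simp add: \<Phi>_def V_def l_def lagrangian_grad[OF H])
  qed
  have Lint: "integrable \<mu> (\<lambda>(x, v). lagrangian H x v)"
    unfolding \<mu>_def by (subst integrable_distr_eq[OF \<Phi>m lagrangian_borel_measurable[OF H]])
      (simp add: Leq int[OF lc])
  have LM: "(\<integral>(x, v). lagrangian H x v \<partial>\<mu>) = (\<integral>t. l (g t) \<partial>M)"
    unfolding \<mu>_def by (subst integral_distr[OF \<Phi>m lagrangian_borel_measurable[OF H]]) (simp add: Leq)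
  have fM: "(\<integral>(x, v). f x \<partial>\<mu>) = (\<integral>t. f (fst (g t)) \<partial>M)"
  proof -
    have meas: "(\<lambda>(x, v). f x) \<in> borel_measurable (borel :: ((real^'n) \<times> (real^'n)) measure)"
      by (intro cont2 fstc fc)
    show ?thesis unfolding \<mu>_def
      by (subst integral_distr[OF \<Phi>m meas]) (simp add: \<Phi>_def periodic_frac[OF fp])
  qed
  \<comment> \<open>Two nonnegative numbers with nonpositive sum: the action is 0, hence minimal,
    and the mean of \<open>f\<close> is 0.\<close>
  have "(\<integral>t. l (g t) \<partial>M) + (\<integral>t. f (fst (g t)) \<partial>M) \<le> 0"
    using hM[of 0] int[OF lc] int[OF fstc[OF fc]] by (simp add: h_def)
  moreover have "0 \<le> (\<integral>t. l (g t) \<partial>M)"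
    using holonomic_action_nonneg[OF H w1 hol Lint] LM by simp
  moreover have "0 \<le> (\<integral>t. f (fst (g t)) \<partial>M)" using f0 by simp
  ultimately have zero: "(\<integral>t. l (g t) \<partial>M) = 0" "(\<integral>t. f (fst (g t)) \<partial>M) = 0" by auto
  have "\<mu> \<in> mather_measures H"
    unfolding mather_measures_def
    using hol Lint LM zero(1) holonomic_action_nonneg[OF H w1] by auto
  moreover have "(\<integral>(x, v). w2 x - w1 x - m \<partial>\<mu>) = 0" using fM zero(2) by (simp add: f_def)
  ultimately show ?thesis by blast
qed

theorem mainTheorem1:
  fixes H :: "real^'n \<Rightarrow> real^'n \<Rightarrow> real"
    and w1 w2 :: "real^'n \<Rightarrow> real"
  assumes "hamiltonian_ok H"
    and "ergodic_constant H = 0"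
    and "visc_sol H 0 w1"
    and "visc_sol H 0 w2"
    and "\<forall>\<mu>\<in>mather_measures H. (\<integral>(x, v). w1 x \<partial>\<mu>) \<le> (\<integral>(x, v). w2 x \<partial>\<mu>)"
  shows "\<forall>x. w1 x \<le> w2 x"
proof -
  have w: "continuous_on UNIV w1" "periodic_fun w1" "continuous_on UNIV w2" "periodic_fun w2"
    using assms(3,4) by (auto simp: visc_sol_def)
  have "continuous_on UNIV (\<lambda>x. w1 x - w2 x)" by (intro continuous_intros w)
  moreover have "periodic_fun (\<lambda>x. w1 x - w2 x)" using w by (simp add: periodic_fun_def)
  ultimately have "\<exists>x. \<forall>y. w1 y - w2 y \<le> w1 x - w2 x" by (rule periodic_attains_sup)
  then obtain x0 where x0: "\<And>y. w1 y - w2 y \<le> w1 x0 - w2 x0" by blast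
  define m where "m = w2 x0 - w1 x0"
  have m: "m \<le> w2 x - w1 x" for x using x0[of x] by (simp add: m_def)
  obtain \<mu> where \<mu>: "\<mu> \<in> mather_measures H" "(\<integral>(x, v). w2 x - w1 x - m \<partial>\<mu>) = 0"
    using mather_measure_concentrated_on_minimum[OF assms(1,3,4) m m_def[symmetric]] by blast
  have "prob_TR \<mu>" using \<mu>(1) by (simp add: mather_measures_def holonomic_def)
  then interpret prob_space \<mu> by (simp add: prob_TR_def)
  \<comment> \<open>The Bochner integral of a nonintegrable function defaults to 0, so splitting the
    integral below requires this.\<close>
  have int: "integrable \<mu> (\<lambda>(x, v). w x)" if w: "continuous_on UNIV w" "periodic_fun w"
    for w :: "real^'n \<Rightarrow> real"
  proof -
    obtain B where "\<And>x. \<bar>w x\<bar> \<le> B" using periodic_bounded[OF w] by metis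
    moreover have "(\<lambda>z. w (fst z)) \<in> borel_measurable \<mu>"
      using borel_measurable_continuous_onI[OF continuous_on_compose2[OF w(1) continuous_on_fst[OF continuous_on_id]]]
        \<open>prob_TR \<mu>\<close> by (simp add: prob_TR_def cong: measurable_cong_sets)
    ultimately show ?thesis by (intro integrable_const_bound[of _ B]) (auto simp: split_beta)
  qed
  note i = int[OF w(1,2)] int[OF w(3,4)]
  have "(\<integral>(x, v). w2 x - w1 x - m \<partial>\<mu>) = (\<integral>(x, v). w2 x \<partial>\<mu>) - (\<integral>(x, v). w1 x \<partial>\<mu>) - m"
    using i by (simp add: case_prod_beta' prob_space)
  then have "m \<ge> 0" using \<mu> assms(5) by auto
  then show ?thesis using m by (metis diff_ge_0_iff_ge order_trans)
qed

end
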